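(* Let $\omega$ be a nonzero real number. Consider the holomorphic system $$\dot x=i\omega x+y+f,\quad \dot y=i\omega y+z+g,\quad \dot z=i\omega z+h,$$ where $f,g,h$ are holomorphic near $0\in\mathbb{C}^3$ and vanish to order at least $2$. Then: 1) The system has a unique $x$-invariant holomorphic center manifold at the origin, and it contains an isochronous center family of period $2\pi/|\omega|$. 2) The system has no $y$-invariant and no $z$-invariant holomorphic center manifold at the origin.
   Context: An $x$-invariant (resp. $y$-, $z$-invariant) holomorphic center manifold at the origin is a germ at $0$ of a one-dimensional complex submanifold of $\mathbb{C}^3$ through $0$ that is invariant under the system and tangent at $0$ to the $x$-axis (resp. $y$-, $z$-axis). Such a manifold $S$ contains an isochronous center family of period $T$ if every real-time trajectory of the system starting at a point of $S\setminus\{0\}$ sufficiently close to $0$ is periodic of period $T$. *)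

theory Defs
  imports "HOL-Analysis.Analysis"
begin

type_synonym c3 = "complex \<times> complex \<times> complex"

definition cscale :: "complex \<Rightarrow> c3 \<Rightarrow> c3" where
  "cscale c v = (c * fst v, c * fst (snd v), c * snd (snd v))"

definition hol3_on :: "c3 set \<Rightarrow> (c3 \<Rightarrow> complex) \<Rightarrow> bool" where
  "hol3_on U f \<longleftrightarrow> open U \<and>
     (\<forall>p\<in>U. \<exists>D. (f has_derivative D) (at p) \<and> (\<forall>v. D (cscale \<i> v) = \<i> * D v))"

definition hol3_near0 :: "(c3 \<Rightarrow> complex) \<Rightarrow> bool" where
  "hol3_near0 f \<longleftrightarrow> (\<exists>U. 0 \<in> U \<and> hol3_on U f)"

definition vanish_order2 :: "(c3 \<Rightarrow> complex) \<Rightarrow> bool" where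
  "vanish_order2 f \<longleftrightarrow> f 0 = 0 \<and> (f has_derivative (\<lambda>_. 0)) (at 0)"

definition sys :: "real \<Rightarrow> (c3 \<Rightarrow> complex) \<Rightarrow> (c3 \<Rightarrow> complex) \<Rightarrow> (c3 \<Rightarrow> complex) \<Rightarrow> c3 \<Rightarrow> c3" where
  "sys \<omega> f g h p = (let x = fst p; y = fst (snd p); z = snd (snd p) in
     (\<i> * of_real \<omega> * x + y + f p, \<i> * of_real \<omega> * y + z + g p, \<i> * of_real \<omega> * z + h p))"

definition cderiv3 :: "(complex \<Rightarrow> c3) \<Rightarrow> complex \<Rightarrow> c3" where
  "cderiv3 \<gamma> s = (deriv (\<lambda>s. fst (\<gamma> s)) s, deriv (\<lambda>s. fst (snd (\<gamma> s))) s,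
                   deriv (\<lambda>s. snd (snd (\<gamma> s))) s)"

text \<open>S (a representative of a germ at 0) is, near 0, a one-dimensional complex
  submanifold through 0 which is invariant under the vector field F and tangent at 0
  to the complex line spanned by the axis vector e: there are an open neighbourhood U of 0
  and a holomorphic immersion gamma of a disc onto S \<inter> U (homeomorphically),
  gamma 0 = 0, gamma'(0) parallel to e, and F is tangent to S along S \<inter> U.\<close>
definition inv_center_manifold :: "(c3 \<Rightarrow> c3) \<Rightarrow> c3 \<Rightarrow> c3 set \<Rightarrow> bool" where
  "inv_center_manifold F e S \<longleftrightarrow> (\<exists>U r \<gamma> \<gamma>inv. open U \<and> 0 \<in> U \<and> r > 0 \<and>
      (\<lambda>s. fst (\<gamma> s)) holomorphic_on ball 0 r \<and>
      (\<lambda>s. fst (snd (\<gamma> s))) holomorphic_on ball 0 r \<and>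
      (\<lambda>s. snd (snd (\<gamma> s))) holomorphic_on ball 0 r \<and>
      \<gamma> 0 = 0 \<and>
      (\<forall>s\<in>ball 0 r. cderiv3 \<gamma> s \<noteq> 0) \<and>
      homeomorphism (ball 0 r) (S \<inter> U) \<gamma> \<gamma>inv \<and>
      (\<exists>c. cderiv3 \<gamma> 0 = cscale c e) \<and>
      (\<forall>s\<in>ball 0 r. \<exists>c. F (\<gamma> s) = cscale c (cderiv3 \<gamma> s)))"

definition x_axis :: c3 where "x_axis = (1, 0, 0)"
definition y_axis :: c3 where "y_axis = (0, 1, 0)"
definition z_axis :: c3 where "z_axis = (0, 0, 1)"

definition same_germ :: "c3 set \<Rightarrow> c3 set \<Rightarrow> bool" where
  "same_germ S S' \<longleftrightarrow> (\<exists>V. open V \<and> 0 \<in> V \<and> S \<inter> V = S' \<inter> V)"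

text \<open>S contains an isochronous center family of period T: every real-time trajectory
  starting at a point of S - {0} sufficiently close to 0 is periodic with (minimal) period T.
  The trajectory is the solution u (defined for all real t); every solution through p on
  any real interval containing 0 coincides with it.\<close>
definition isochronous_family :: "(c3 \<Rightarrow> c3) \<Rightarrow> c3 set \<Rightarrow> real \<Rightarrow> bool" where
  "isochronous_family F S T \<longleftrightarrow> (\<exists>\<delta>>0. \<forall>p\<in>S. p \<noteq> 0 \<and> norm p < \<delta> \<longrightarrow>
     (\<exists>u :: real \<Rightarrow> c3. u 0 = p \<and>
        (\<forall>t. (u has_vector_derivative F (u t)) (at t)) \<and>
        (\<forall>t. u (t + T) = u t) \<and>
        (\<forall>t. 0 < t \<and> t < T \<longrightarrow> u t \<noteq> p) \<and>
        (\<forall>J v. is_interval J \<and> 0 \<in> J \<and> v 0 = p \<and>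
           (\<forall>t\<in>J. (v has_vector_derivative F (v t)) (at t within J)) \<longrightarrow>
           (\<forall>t\<in>J. v t = u t))))"

end

theory Submission
  imports Defs "HOL-Complex_Analysis.Conformal_Mappings"
begin

text \<open>Write \<open>\<mu> = \<i>\<omega>\<close>. A holomorphic curve \<open>u\<close> with \<open>\<mu> s u'(s) = F(u(s))\<close>, \<open>u(0) = 0\<close> and \<open>u'(0)\<close> the
  \<open>x\<close>-axis parametrises an invariant manifold on which the flow is the rotation \<open>s \<mapsto> e\<^sup>\<mu>\<^sup>t s\<close>, so all
  orbits on it have period \<open>2\<pi>/\<bar>\<omega>\<bar>\<close>. Such a curve is the fixed point of a contraction on the curves
  \<open>s (1, 0, 0) + w(s)\<close> with \<open>w = O(s\<^sup>2)\<close>, in the norm \<open>sup \<bar>w(s)\<bar>/\<bar>s\<bar>\<^sup>2\<close>: since \<open>n\<mu> \<noteq> \<mu>\<close> for \<open>n \<ge> 2\<close>, the operator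
  \<open>w \<mapsto> \<mu> s w' - (\<mu> + N) w\<close> has a bounded inverse there, while the nonlinearity has an arbitrarily
  small Lipschitz constant near \<open>0\<close>. The same estimate shows
  uniqueness: any other invariant curve tangent to the \<open>x\<close>-axis solves this equation, with the same
  first-order part, after a holomorphic change of its parameter. Finally, the tangent line of an invariant curve is an eigenline of the Jordan block,
  which excludes the \<open>y\<close>- and \<open>z\<close>-axes.\<close>

section \<open>Holomorphic curves and holomorphic functions on \<open>\<complex>\<^sup>3\<close>\<close>

text \<open>Componentwise, with the same three conjuncts as in \<open>inv_center_manifold\<close>,
  so that scalar complex analysis applies and the two notions unfold to each other.\<close>

definition hcurve :: "complex set \<Rightarrow> (complex \<Rightarrow> c3) \<Rightarrow> bool" where
  "hcurve B \<gamma> \<longleftrightarrow> (\<lambda>s. fst (\<gamma> s)) holomorphic_on B \<and>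
     (\<lambda>s. fst (snd (\<gamma> s))) holomorphic_on B \<and> (\<lambda>s. snd (snd (\<gamma> s))) holomorphic_on B"

lemma norm_fst_snd_le: "norm (fst (snd p)) \<le> norm (p :: c3)"
  using norm_fst_le[of "fst (snd p)" "snd (snd p)"] norm_snd_le[of "snd p" "fst p"] by simp

lemma norm_snd_snd_le: "norm (snd (snd p)) \<le> norm (p :: c3)"
  using norm_snd_le[of "snd (snd p)" "fst (snd p)"] norm_snd_le[of "snd p" "fst p"] by simp

lemma norm_fst_le': "norm (fst p) \<le> norm (p :: c3)"
  using norm_fst_le[of "fst p" "snd p"] by simp

lemma norm_c3_le_sum:
  "norm (p :: c3) \<le> norm (fst p) + norm (fst (snd p)) + norm (snd (snd p))"
  using norm_Pair_le[of "fst p" "snd p"] norm_Pair_le[of "fst (snd p)" "snd (snd p)"] by simp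

lemma norm_cscale: "norm (cscale c v) = norm c * norm v"
proof -
  have "(norm (cscale c v))\<^sup>2 = (norm c * norm v)\<^sup>2"
    by (cases v) (auto simp: cscale_def norm_Pair norm_mult power_mult_distrib algebra_simps)
  then show ?thesis by (simp add: power2_eq_iff_nonneg)
qed

lemma hcurve_subset: "hcurve B \<gamma> \<Longrightarrow> C \<subseteq> B \<Longrightarrow> hcurve C \<gamma>"
  unfolding hcurve_def by (meson holomorphic_on_subset)

lemma hcurve_smaller_ball: "hcurve (ball 0 R) \<gamma> \<Longrightarrow> R' \<le> R \<Longrightarrow> hcurve (ball 0 R') \<gamma>"
  by (erule hcurve_subset) (rule subset_ball)

lemma hcurve_continuous_on: "hcurve B \<gamma> \<Longrightarrow> continuous_on B \<gamma>"
proof -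
  assume h: "hcurve B \<gamma>"
  have "continuous_on B (\<lambda>s. (fst (\<gamma> s), fst (snd (\<gamma> s)), snd (snd (\<gamma> s))))"
    using h unfolding hcurve_def
    by (intro continuous_on_Pair holomorphic_on_imp_continuous_on) auto
  then show ?thesis by simp
qed

lemma hcurve_isCont: "hcurve B \<gamma> \<Longrightarrow> open B \<Longrightarrow> s \<in> B \<Longrightarrow> isCont \<gamma> s"
  using hcurve_continuous_on[of B \<gamma>] by (simp add: continuous_on_eq_continuous_at)

text \<open>Three scalar complex derivatives are packed into one real Frechet derivative. Sums and
  compositions of curves can then be differentiated in one go; \<open>has_derivative_cscaleD\<close>
  leads back to the components.\<close>

lemma hcurve_has_derivative:
  assumes "hcurve B \<gamma>" "open B" "s \<in> B"
  shows "(\<gamma> has_derivative (\<lambda>\<zeta>. cscale \<zeta> (cderiv3 \<gamma> s))) (at s)"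
proof -
  have "((\<lambda>s. (fst (\<gamma> s), fst (snd (\<gamma> s)), snd (snd (\<gamma> s)))) has_derivative
     (\<lambda>\<zeta>. (deriv (\<lambda>s. fst (\<gamma> s)) s * \<zeta>, deriv (\<lambda>s. fst (snd (\<gamma> s))) s * \<zeta>,
        deriv (\<lambda>s. snd (snd (\<gamma> s))) s * \<zeta>))) (at s)"
    using assms unfolding hcurve_def
    by (intro has_derivative_Pair) 
       (auto intro!: has_field_derivative_imp_has_derivative holomorphic_derivI)
  then show ?thesis by (simp add: cscale_def cderiv3_def mult.commute)
qed

text \<open>A real-linear map commuting with multiplication by \<open>\<i>\<close> is complex
  linear: split \<zeta> into real and imaginary part.\<close>

lemma clinear_cscale:
  assumes "linear D" "\<And>v. D (cscale \<i> v) = \<i> * D v"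
  shows "D (cscale \<zeta> v) = \<zeta> * D v"
proof -
  have "cscale \<zeta> v = Re \<zeta> *\<^sub>R v + Im \<zeta> *\<^sub>R cscale \<i> v"
    by (cases v) (auto simp: cscale_def complex_eq_iff)
  then have "D (cscale \<zeta> v) = Re \<zeta> *\<^sub>R D v + Im \<zeta> *\<^sub>R (\<i> * D v)"
    using assms by (simp add: linear_add linear_scale)
  also have "\<dots> = \<zeta> * D v" by (auto simp: complex_eq_iff)
  finally show ?thesis .
qed

lemma hol3_on_subset: "hol3_on U f \<Longrightarrow> V \<subseteq> U \<Longrightarrow> open V \<Longrightarrow> hol3_on V f"
  unfolding hol3_on_def by blast

lemma hol3_on_compose_deriv:
  assumes "hcurve B \<gamma>" "open B" "s \<in> B"
    and D: "(f has_derivative D) (at (\<gamma> s))" "\<And>v. D (cscale \<i> v) = \<i> * D v"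
  shows "((\<lambda>s. f (\<gamma> s)) has_field_derivative D (cderiv3 \<gamma> s)) (at s)"
proof -
  have "((\<lambda>s. f (\<gamma> s)) has_derivative (\<lambda>\<zeta>. D (cscale \<zeta> (cderiv3 \<gamma> s)))) (at s)"
    using has_derivative_compose[OF hcurve_has_derivative[OF assms(1-3)] D(1)] .
  moreover have "D (cscale \<zeta> (cderiv3 \<gamma> s)) = D (cderiv3 \<gamma> s) * \<zeta>" for \<zeta>
    using clinear_cscale[OF has_derivative_linear[OF D(1)] D(2)] by (simp add: mult.commute)
  ultimately show ?thesis by (simp add: has_field_derivative_def)
qed

lemma hol3_on_compose:
  assumes "hol3_on U f" "hcurve B \<gamma>" "open B" "\<gamma> ` B \<subseteq> U"
  shows "(\<lambda>s. f (\<gamma> s)) holomorphic_on B"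
  unfolding holomorphic_on_open[OF \<open>open B\<close>]
proof
  fix s assume s: "s \<in> B"
  then obtain D where "(f has_derivative D) (at (\<gamma> s))" "\<forall>v. D (cscale \<i> v) = \<i> * D v"
    using assms unfolding hol3_on_def by blast
  then show "\<exists>f'. ((\<lambda>s. f (\<gamma> s)) has_field_derivative f') (at s)"
    using hol3_on_compose_deriv[OF assms(2,3) s] by blast
qed

lemma vanish_order2_compose:
  assumes "vanish_order2 f" "hcurve B \<gamma>" "open B" "0 \<in> B" "\<gamma> 0 = 0"
  shows "((\<lambda>s. f (\<gamma> s)) has_field_derivative 0) (at 0)"
  using hol3_on_compose_deriv[OF assms(2-4), of f "\<lambda>_. 0"] assms
  by (simp add: vanish_order2_def)

text \<open>Order-two vanishing controls the derivative at 0 only. Since it gives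
  \<open>f p = o(norm p)\<close>, Cauchy's inequality on complex lines through nearby points bounds
  the derivative there as well, and the mean value inequality turns this into a Lipschitz bound with
  an arbitrarily small constant.\<close>

lemma hol3_small_lipschitz:
  assumes "hol3_near0 f" "vanish_order2 f" "\<epsilon> > 0"
  obtains \<rho> where "\<rho> > 0" "hol3_on (ball 0 \<rho>) f"
    "\<And>p q. p \<in> ball 0 \<rho> \<Longrightarrow> q \<in> ball 0 \<rho> \<Longrightarrow> norm (f p - f q) \<le> \<epsilon> * norm (p - q)"
proof -
  obtain U where U: "0 \<in> U" "hol3_on U f" using assms(1) unfolding hol3_near0_def by auto
  then obtain R where R: "R > 0" "ball 0 R \<subseteq> U"
    unfolding hol3_on_def by (meson openE)
  have f0: "f 0 = 0" "(f has_derivative (\<lambda>_. 0)) (at 0)"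
    using assms(2) unfolding vanish_order2_def by auto
  obtain d where d: "d > 0" "\<And>p. norm p < d \<Longrightarrow> norm (f p) \<le> \<epsilon> / 2 * norm p"
  proof -
    have "\<forall>e>0. \<exists>d>0. \<forall>y. norm (y - 0) < d \<longrightarrow> norm (f y - f 0 - 0) \<le> e * norm (y - 0)"
      using f0(2) unfolding has_derivative_at_alt by blast
    then have "\<exists>d>0. \<forall>y. norm (y - 0) < d \<longrightarrow> norm (f y - f 0 - 0) \<le> \<epsilon>/2 * norm (y - 0)"
      using \<open>\<epsilon> > 0\<close> by (meson half_gt_zero)
    then show ?thesis using that f0(1) by auto
  qed
  \<comment> \<open>Around a point of \<open>ball 0 \<rho>\<close>, the Cauchy circle of radius
    \<rho> stays in \<open>ball 0 (2 * \<rho>)\<close>, and an open disc containing the closed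
    Cauchy disc stays in \<open>ball 0 (3 * \<rho>)\<close>.\<close>
  define \<rho> where "\<rho> = min R d / 3"
  have \<rho>: "\<rho> > 0" "3 * \<rho> \<le> R" "3 * \<rho> \<le> d" using R d by (auto simp: \<rho>_def)
  have hol: "hol3_on (ball 0 (3 * \<rho>)) f"
    using U R(2) \<rho>(2) by (intro hol3_on_subset[OF U(2)]) auto
  have "\<exists>D. (f has_derivative D) (at p) \<and> onorm D \<le> \<epsilon>" if p: "p \<in> ball 0 \<rho>" for p
  proof -
    obtain D where D: "(f has_derivative D) (at p)" "\<And>v. D (cscale \<i> v) = \<i> * D v"
    proof -
      have "p \<in> ball 0 (3 * \<rho>)" using p \<rho>(1) by simp
      then show ?thesis using hol that unfolding hol3_on_def by blast
    qed
    have lin: "linear D" using D(1) has_derivative_linear by blast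
    have "norm (D v) \<le> \<epsilon> * norm v" for v
    proof (cases "v = 0")
      case True then show ?thesis using lin by (simp add: linear_0)
    next
      case False
      \<comment> \<open>The parameter circle of radius \<open>r\<close> is a circle of radius \<rho>
        on the line, so the bound \<open>\<epsilon> * \<rho> / r\<close> from Cauchy's inequality is
        exactly \<open>\<epsilon> * norm v\<close>.\<close>
      define r where "r = \<rho> / norm v"
      have r: "r > 0" "r * norm v = \<rho>" using False \<rho> by (auto simp: r_def)
      define l where "l \<zeta> = p + cscale \<zeta> v" for \<zeta>
      have hl: "hcurve UNIV l"
        unfolding hcurve_def l_def cscale_def by (auto intro!: holomorphic_intros)
      have cd: "cderiv3 l 0 = v"
      proof -
        have 1: "deriv (\<lambda>s. a + s * b) 0 = b" for a b :: complex
          by (rule DERIV_imp_deriv) (auto intro!: derivative_eq_intros)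
        show ?thesis unfolding cderiv3_def l_def cscale_def by (simp add: 1)
      qed
      define B where "B = ball (0::complex) (2 * r)"
      have nl: "norm (l \<zeta>) < \<rho> + norm \<zeta> * norm v" for \<zeta>
        using norm_triangle_ineq[of p "cscale \<zeta> v"] p unfolding l_def norm_cscale by auto
      have lB: "l ` B \<subseteq> ball 0 (3 * \<rho>)"
      proof
        fix q assume "q \<in> l ` B"
        then obtain \<zeta> where \<zeta>: "q = l \<zeta>" "norm \<zeta> < 2 * r" by (auto simp: B_def)
        have "norm \<zeta> * norm v \<le> 2 * r * norm v" using \<zeta> by (intro mult_right_mono) auto
        then have "norm \<zeta> * norm v \<le> 2 * \<rho>" using r(2) by (simp add: mult.assoc)
        then show "q \<in> ball 0 (3 * \<rho>)" using nl[of \<zeta>] \<zeta> by simp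
      qed
      have fl: "(\<lambda>\<zeta>. f (l \<zeta>)) holomorphic_on B"
        by (rule hol3_on_compose[OF hol hcurve_subset[OF hl] _ lB]) (auto simp: B_def)
      have "norm ((deriv ^^ 1) (\<lambda>\<zeta>. f (l \<zeta>)) 0) \<le> fact 1 * (\<epsilon> * \<rho>) / r ^ 1"
      proof (rule Cauchy_inequality)
        show "(\<lambda>\<zeta>. f (l \<zeta>)) holomorphic_on ball 0 r"
          using r by (intro holomorphic_on_subset[OF fl]) (auto simp: B_def)
        show "continuous_on (cball 0 r) (\<lambda>\<zeta>. f (l \<zeta>))"
          using r by (intro continuous_on_subset[OF holomorphic_on_imp_continuous_on[OF fl]])
            (auto simp: B_def)
        fix \<zeta> :: complex assume "norm (0 - \<zeta>) = r"
        then have n: "norm (l \<zeta>) < 2 * \<rho>" using nl[of \<zeta>] r by simp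
        then have "norm (f (l \<zeta>)) \<le> \<epsilon> / 2 * norm (l \<zeta>)" using d(2) \<rho> by auto
        also have "\<dots> \<le> \<epsilon> / 2 * (2 * \<rho>)" using n \<open>\<epsilon> > 0\<close> by (intro mult_left_mono) auto
        finally show "norm (f (l \<zeta>)) \<le> \<epsilon> * \<rho>" by simp
      qed (use r in auto)
      moreover have "deriv (\<lambda>\<zeta>. f (l \<zeta>)) 0 = D v"
        using hol3_on_compose_deriv[OF hl, of 0 f D] D cd
        by (intro DERIV_imp_deriv) (simp add: l_def cscale_def zero_prod_def[symmetric])
      ultimately have "norm (D v) \<le> \<epsilon> * \<rho> / r" by simp
      also have "\<dots> = \<epsilon> * norm v" using r by (simp add: field_simps)
      finally show ?thesis .
    qed
    then have "onorm D \<le> \<epsilon>" by (rule onorm_le)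
    then show ?thesis using D(1) by blast
  qed
  then obtain D where D: "\<And>p. p \<in> ball 0 \<rho> \<Longrightarrow> (f has_derivative D p) (at p)"
     "\<And>p. p \<in> ball 0 \<rho> \<Longrightarrow> onorm (D p) \<le> \<epsilon>" by metis
  have "norm (f p - f q) \<le> \<epsilon> * norm (p - q)" if "p \<in> ball 0 \<rho>" "q \<in> ball 0 \<rho>" for p q
    using D(2) that has_derivative_at_withinI[OF D(1)]
    by (intro differentiable_bound[of "ball 0 \<rho>" f D]) auto
  moreover have "hol3_on (ball 0 \<rho>) f"
    using hol3_on_subset[OF hol] \<rho>(1) by (simp add: subset_ball)
  ultimately show ?thesis using that \<rho>(1) by blast
qed

section \<open>Factoring out zeros, and primitives on discs\<close>

lemma holomorphic_factor_zero:
  assumes "v holomorphic_on ball 0 r" "v 0 = 0"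
  shows "\<exists>q. q holomorphic_on ball 0 r \<and> (\<forall>s. v s = s * q s) \<and> q 0 = deriv v 0"
proof (intro exI conjI)
  show "(\<lambda>z. if z = 0 then deriv v 0 else (v z - v 0)/(z-0)) holomorphic_on ball 0 r"
    by (rule pole_lemma_open) (use assms in auto)
qed (use assms in auto)

text \<open>The first factorisation leaves a quotient whose value at 0 is
  \<open>deriv v 0 = 0\<close>, so it can be applied again.\<close>

lemma holomorphic_factor_double_zero:
  assumes "v holomorphic_on ball 0 r" "v 0 = 0" "deriv v 0 = 0"
  obtains q where "q holomorphic_on ball 0 r" "\<And>s. v s = s\<^sup>2 * q s"
proof -
  obtain q where q: "q holomorphic_on ball 0 r" "\<forall>s. v s = s * q s" "q 0 = 0"
    using holomorphic_factor_zero[OF assms(1,2)] assms(3) by auto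
  obtain p where p: "p holomorphic_on ball 0 r" "\<forall>s. q s = s * p s"
    using holomorphic_factor_zero[OF q(1,3)] by auto
  show ?thesis 
  proof (rule that[OF p(1)])
    show "v s = s\<^sup>2 * p s" for s
      using q(2)[rule_format, of s] p(2)[rule_format, of s] 
      by (simp only: power2_eq_square mult.assoc)
  qed
qed

lemma holomorphic_primitive_ball:
  assumes "f holomorphic_on ball 0 r"
  obtains g where "\<And>x. x \<in> ball 0 r \<Longrightarrow> (g has_field_derivative f x) (at x)"
    "g holomorphic_on ball 0 r" "g 0 = 0"
proof -
  obtain g where g: "\<And>x. x \<in> ball 0 r \<Longrightarrow> (g has_field_derivative f x) (at x within ball 0 r)"
    using holomorphic_convex_primitive'[of "ball 0 r" f] assms by auto
  have g': "((\<lambda>x. g x - g 0) has_field_derivative f x) (at x)" if "x \<in> ball 0 r" for x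
    using g[OF that] that at_within_open[OF that] DERIV_diff[OF _ DERIV_const] by fastforce
  then have "(\<lambda>x. g x - g 0) holomorphic_on ball 0 r"
    using holomorphic_on_open[OF open_ball] by blast
  then show ?thesis using that[OF g'] by simp
qed

section \<open>Calculus of holomorphic curves\<close>

lemma has_derivative_cscaleD:
  assumes "(\<gamma> has_derivative (\<lambda>\<zeta>. cscale \<zeta> v)) (at s)"
  shows "((\<lambda>s. fst (\<gamma> s)) has_field_derivative fst v) (at s)"
    "((\<lambda>s. fst (snd (\<gamma> s))) has_field_derivative fst (snd v)) (at s)"
    "((\<lambda>s. snd (snd (\<gamma> s))) has_field_derivative snd (snd v)) (at s)"
    "cderiv3 \<gamma> s = v"
proof -
  note d = has_derivative_fst[OF assms] has_derivative_fst[OF has_derivative_snd[OF assms]]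
    has_derivative_snd[OF has_derivative_snd[OF assms]]
  show 1: "((\<lambda>s. fst (\<gamma> s)) has_field_derivative fst v) (at s)"
    using d(1) by (simp add: has_field_derivative_def cscale_def mult_commute_abs)
  show 2: "((\<lambda>s. fst (snd (\<gamma> s))) has_field_derivative fst (snd v)) (at s)"
    using d(2) by (simp add: has_field_derivative_def cscale_def mult_commute_abs)
  show 3: "((\<lambda>s. snd (snd (\<gamma> s))) has_field_derivative snd (snd v)) (at s)"
    using d(3) by (simp add: has_field_derivative_def cscale_def mult_commute_abs)
  show "cderiv3 \<gamma> s = v"
    using 1 2 3 by (simp add: cderiv3_def DERIV_imp_deriv)
qed

lemma hcurveI:
  assumes "open B" "\<And>s. s \<in> B \<Longrightarrow> (\<gamma> has_derivative (\<lambda>\<zeta>. cscale \<zeta> (v s))) (at s)"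
  shows "hcurve B \<gamma>"
  unfolding hcurve_def holomorphic_on_open[OF assms(1)]
  using has_derivative_cscaleD(1-3)[OF assms(2)] by blast

lemma cscale_diff: "cscale \<zeta> (v - w) = cscale \<zeta> v - cscale \<zeta> w"
  by (simp add: cscale_def algebra_simps)

lemma cscale_add: "cscale \<zeta> (v + w) = cscale \<zeta> v + cscale \<zeta> w"
  by (simp add: cscale_def algebra_simps)

lemma cscale_cscale: "cscale a (cscale b v) = cscale (a * b) v"
  by (simp add: cscale_def algebra_simps)

lemma hcurve_diff:
  assumes "hcurve B \<gamma>" "hcurve B \<eta>" "open B"
  shows "hcurve B (\<lambda>s. \<gamma> s - \<eta> s)"
    and "s \<in> B \<Longrightarrow> cderiv3 (\<lambda>s. \<gamma> s - \<eta> s) s = cderiv3 \<gamma> s - cderiv3 \<eta> s"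
proof -
  have d: "((\<lambda>s. \<gamma> s - \<eta> s) has_derivative (\<lambda>\<zeta>. cscale \<zeta> (cderiv3 \<gamma> s - cderiv3 \<eta> s))) (at s)"
    if "s \<in> B" for s
    unfolding cscale_diff
    by (intro has_derivative_diff hcurve_has_derivative[OF _ assms(3) that] assms)
  show "hcurve B (\<lambda>s. \<gamma> s - \<eta> s)" using hcurveI[OF assms(3) d] .
  show "s \<in> B \<Longrightarrow> cderiv3 (\<lambda>s. \<gamma> s - \<eta> s) s = cderiv3 \<gamma> s - cderiv3 \<eta> s"
    using has_derivative_cscaleD(4)[OF d] .
qed

lemma hcurve_add:
  assumes "hcurve B \<gamma>" "hcurve B \<eta>" "open B"
  shows "hcurve B (\<lambda>s. \<gamma> s + \<eta> s)"
    and "s \<in> B \<Longrightarrow> cderiv3 (\<lambda>s. \<gamma> s + \<eta> s) s = cderiv3 \<gamma> s + cderiv3 \<eta> s"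
proof -
  have d: "((\<lambda>s. \<gamma> s + \<eta> s) has_derivative (\<lambda>\<zeta>. cscale \<zeta> (cderiv3 \<gamma> s + cderiv3 \<eta> s))) (at s)"
    if "s \<in> B" for s
    unfolding cscale_add
    by (intro has_derivative_add hcurve_has_derivative[OF _ assms(3) that] assms)
  show "hcurve B (\<lambda>s. \<gamma> s + \<eta> s)" using hcurveI[OF assms(3) d] .
  show "s \<in> B \<Longrightarrow> cderiv3 (\<lambda>s. \<gamma> s + \<eta> s) s = cderiv3 \<gamma> s + cderiv3 \<eta> s"
    using has_derivative_cscaleD(4)[OF d] .
qed

lemma hcurve_compose_deriv:
  assumes "hcurve B \<gamma>" "open B" "\<psi> s \<in> B" "(\<psi> has_field_derivative d) (at s)"
  shows "((\<lambda>s. \<gamma> (\<psi> s)) has_derivative (\<lambda>\<zeta>. cscale \<zeta> (cscale d (cderiv3 \<gamma> (\<psi> s))))) (at s)"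
  using has_derivative_compose[OF has_field_derivative_imp_has_derivative[OF assms(4)]
      hcurve_has_derivative[OF assms(1-3)]]
  by (simp add: cscale_cscale mult.commute)

section \<open>The linearised invariance equation\<close>

definition jblock :: "complex \<Rightarrow> c3 \<Rightarrow> c3" where
  "jblock \<mu> p = (\<mu> * fst p + fst (snd p), \<mu> * fst (snd p) + snd (snd p), \<mu> * snd (snd p))"

text \<open>Order 1 is the resonant order: on terms \<open>s * a\<close> the operator
  \<open>\<mu> s W' - jblock \<mu> W\<close> reduces to minus the nilpotent part of the Jordan
  block. Starting at order 2 removes this kernel.\<close>

definition flat_curve :: "real \<Rightarrow> (complex \<Rightarrow> c3) \<Rightarrow> bool" where
  "flat_curve r \<gamma> \<longleftrightarrow> hcurve (ball 0 r) \<gamma> \<and> \<gamma> 0 = 0 \<and> cderiv3 \<gamma> 0 = 0"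

lemma flat_curveD:
  assumes "flat_curve r \<gamma>"
  shows "(\<lambda>s. fst (\<gamma> s)) holomorphic_on ball 0 r" "fst (\<gamma> 0) = 0" "deriv (\<lambda>s. fst (\<gamma> s)) 0 = 0"
    "(\<lambda>s. fst (snd (\<gamma> s))) holomorphic_on ball 0 r" "fst (snd (\<gamma> 0)) = 0"
    "deriv (\<lambda>s. fst (snd (\<gamma> s))) 0 = 0"
    "(\<lambda>s. snd (snd (\<gamma> s))) holomorphic_on ball 0 r" "snd (snd (\<gamma> 0)) = 0"
    "deriv (\<lambda>s. snd (snd (\<gamma> s))) 0 = 0"
  using assms by (auto simp: flat_curve_def hcurve_def cderiv3_def zero_prod_def)

text \<open>The substitution \<open>W = s \<tau> \<Psi>\<close> turns the left-hand side of the hypothesis into \<open>s\<^sup>2 e \<tau> \<Psi>'\<close>.\<close>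

lemma euler_estimate:
  fixes e \<tau> W :: "complex \<Rightarrow> complex"
  assumes m: "m > 0" and hol: "\<tau> holomorphic_on ball 0 r" "W holomorphic_on ball 0 r"
    and W0: "W 0 = 0" "deriv W 0 = 0"
    and rel: "\<And>s. s \<in> ball 0 r \<Longrightarrow> e s * (\<tau> s + s * deriv \<tau> s) = \<mu> * \<tau> s"
    and lo: "\<And>s. s \<in> ball 0 r \<Longrightarrow> m \<le> norm (e s * \<tau> s)"
    and hi: "\<And>s. s \<in> ball 0 r \<Longrightarrow> norm (\<tau> s) \<le> m'"
    and bd: "\<And>s. s \<in> ball 0 r \<Longrightarrow> norm (s * e s * deriv W s - \<mu> * W s) \<le> B * (norm s)\<^sup>2"
    and s: "s \<in> ball 0 r"
  shows "norm (W s) \<le> m' / m * B * (norm s)\<^sup>2"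
proof (cases "s = 0")
  case True then show ?thesis using W0 by simp
next
  case False
  obtain q where q: "q holomorphic_on ball 0 r" "\<And>s. W s = s\<^sup>2 * q s"
    using holomorphic_factor_double_zero[OF hol(2) W0] by blast
  have nz: "\<tau> s \<noteq> 0" if "s \<in> ball 0 r" for s using lo[OF that] m by auto
  \<comment> \<open>This is \<open>W s / (s * \<tau> s)\<close> away from 0; written with
    \<open>q\<close> it is visibly holomorphic at 0 and vanishes there.\<close>
  define \<Psi> where "\<Psi> s = s * q s / \<tau> s" for s
  have hP: "\<Psi> holomorphic_on ball 0 r"
    unfolding \<Psi>_def using nz by (intro holomorphic_intros q hol) auto
  have WP: "W s = s * \<tau> s * \<Psi> s" if "s \<in> ball 0 r" for s
    using nz[OF that] by (simp add: q(2) \<Psi>_def power2_eq_square)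
  have dW: "deriv W s = \<tau> s * \<Psi> s + s * deriv \<tau> s * \<Psi> s + s * \<tau> s * deriv \<Psi> s"
    if "s \<in> ball 0 r" for s
  proof (rule DERIV_imp_deriv)
    have "((\<lambda>s. s * \<tau> s * \<Psi> s) has_field_derivative
       \<tau> s * \<Psi> s + s * deriv \<tau> s * \<Psi> s + s * \<tau> s * deriv \<Psi> s) (at s)"
      by (rule derivative_eq_intros refl holomorphic_derivI[OF hol(1) _ that]
          holomorphic_derivI[OF hP _ that] | simp add: algebra_simps)+
    then show "(W has_field_derivative
       \<tau> s * \<Psi> s + s * deriv \<tau> s * \<Psi> s + s * \<tau> s * deriv \<Psi> s) (at s)"
      by (rule has_field_derivative_transform_within_open[OF _ open_ball that]) (simp add: WP)
  qed
  have dP: "norm (deriv \<Psi> s) \<le> B / m" if s: "s \<in> ball 0 r" "s \<noteq> 0" for s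
  proof -
    have "s * e s * deriv W s - \<mu> * W s
        = s * (e s * (\<tau> s + s * deriv \<tau> s) - \<mu> * \<tau> s) * \<Psi> s + s\<^sup>2 * (e s * \<tau> s) * deriv \<Psi> s"
      unfolding dW[OF s(1)] WP[OF s(1)] by (simp add: algebra_simps power2_eq_square)
    also have "\<dots> = s\<^sup>2 * (e s * \<tau> s) * deriv \<Psi> s" using rel[OF s(1)] by simp
    finally have "(norm s)\<^sup>2 * (norm (e s * \<tau> s) * norm (deriv \<Psi> s)) \<le> (norm s)\<^sup>2 * B"
      using bd[OF s(1)] by (simp add: norm_mult norm_power mult_ac)
    then have "norm (e s * \<tau> s) * norm (deriv \<Psi> s) \<le> B" using s by simp
    moreover have "m * norm (deriv \<Psi> s) \<le> norm (e s * \<tau> s) * norm (deriv \<Psi> s)"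
      by (intro mult_right_mono lo s) simp
    ultimately show ?thesis using m by (simp add: field_simps)
  qed
  have r: "r > 0" using s by (auto intro: le_less_trans[OF norm_ge_zero])
  \<comment> \<open>The bound \<open>dP\<close> was obtained by cancelling \<open>s\<^sup>2\<close>,
    so at 0 it has to come from continuity of the derivative.\<close>
  have "norm (deriv \<Psi> 0) \<le> B / m"
  proof (rule tendsto_upperbound)
    have "isCont (deriv \<Psi>) 0"
      using holomorphic_on_imp_continuous_on[OF holomorphic_deriv[OF hP open_ball]] r
      by (simp add: continuous_on_eq_continuous_at)
    then show "((\<lambda>s. norm (deriv \<Psi> s)) \<longlongrightarrow> norm (deriv \<Psi> 0)) (at 0)"
      unfolding isCont_def by (rule tendsto_norm)
    have "\<forall>\<^sub>F s in at 0. s \<in> ball 0 r \<and> s \<noteq> (0::complex)"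
      unfolding eventually_at using r by (auto simp: dist_commute)
    then show "\<forall>\<^sub>F s in at 0. norm (deriv \<Psi> s) \<le> B / m"
      by (rule eventually_mono) (use dP in auto)
  qed auto
  \<comment> \<open>Integrating the derivative bound from 0 gains one power of \<open>s\<close>; the
    other comes from the factor \<open>s\<close> in \<open>W = s \<tau> \<Psi>\<close>.\<close>
  then have "norm (\<Psi> s - \<Psi> 0) \<le> B / m * norm (s - 0)"
    using dP s r holomorphic_derivI[OF hP open_ball]
    by (intro field_differentiable_bound[of "ball 0 r" \<Psi> "deriv \<Psi>"]) (metis convex_ball | simp)+
  then have P: "norm (\<Psi> s) \<le> B / m * norm s" by (simp add: \<Psi>_def)
  have "norm (W s) = norm s * norm (\<tau> s) * norm (\<Psi> s)" using WP[OF s] by (simp add: norm_mult)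
  also have "\<dots> \<le> norm s * m' * (B / m * norm s)"
    using P hi[OF s] order_trans[OF norm_ge_zero hi[OF s]]
    by (intro mult_mono) auto
  finally show ?thesis by (simp add: power2_eq_square mult_ac)
qed

text \<open>If \<open>C\<close> is the constant of the scalar estimate, back-substitution gives the
  constants \<open>C\<close>, \<open>C * (1 + C)\<close> and \<open>C * (1 + C * (1 + C))\<close>
  for the third, second and first components; this is their sum.\<close>

definition jconst :: "real \<Rightarrow> real" where
  "jconst C = C * (1 + C * (1 + C)) + C * (1 + C) + C"

lemma jconst_pos: "C > 0 \<Longrightarrow> jconst C > 0"
  unfolding jconst_def by (simp add: add_pos_pos)

text \<open>Back-substitution through the Jordan chain: the third component satisfies a scalar
  equation, and each earlier one has the component after it, already bounded, as an additional
  source term.\<close>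

lemma jordan_estimate:
  assumes m: "m > 0" and hol: "\<tau> holomorphic_on ball 0 r" and W: "flat_curve r W"
    and rel: "\<And>s. s \<in> ball 0 r \<Longrightarrow> e s * (\<tau> s + s * deriv \<tau> s) = \<mu> * \<tau> s"
    and lo: "\<And>s. s \<in> ball 0 r \<Longrightarrow> m \<le> norm (e s * \<tau> s)"
    and hi: "\<And>s. s \<in> ball 0 r \<Longrightarrow> norm (\<tau> s) \<le> m'"
    and bd: "\<And>s. s \<in> ball 0 r \<Longrightarrow>
       norm (cscale (s * e s) (cderiv3 W s) - jblock \<mu> (W s)) \<le> B * (norm s)\<^sup>2"
    and s: "s \<in> ball 0 r"
  shows "norm (W s) \<le> jconst (m' / m) * B * (norm s)\<^sup>2"
proof -
  define C where "C = m' / m"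
  note est = euler_estimate[OF m hol _ _ _ rel lo hi, folded C_def]
  note D = flat_curveD[OF W]
  have W3: "norm (snd (snd (W s))) \<le> C * B * (norm s)\<^sup>2" if s: "s \<in> ball 0 r" for s
  proof (rule est[OF D(7-9) _ _ _ _ s])
    fix s :: complex assume "s \<in> ball 0 r"
    from order_trans[OF norm_snd_snd_le bd[OF this]]
    show "norm (s * e s * deriv (\<lambda>s. snd (snd (W s))) s - \<mu> * snd (snd (W s))) \<le> B * (norm s)\<^sup>2"
      by (simp add: cscale_def cderiv3_def jblock_def)
  qed
  have W2: "norm (fst (snd (W s))) \<le> C * (B + C * B) * (norm s)\<^sup>2" if s: "s \<in> ball 0 r" for s
  proof (rule est[OF D(4-6) _ _ _ _ s])
    fix s :: complex assume s: "s \<in> ball 0 r"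
    from order_trans[OF norm_fst_snd_le bd[OF this]]
    have "norm ((s * e s * deriv (\<lambda>s. fst (snd (W s))) s - \<mu> * fst (snd (W s))) - snd (snd (W s)))
        \<le> B * (norm s)\<^sup>2"
      by (simp add: cscale_def cderiv3_def jblock_def algebra_simps)
    with W3[OF s] show "norm (s * e s * deriv (\<lambda>s. fst (snd (W s))) s - \<mu> * fst (snd (W s)))
        \<le> (B + C * B) * (norm s)\<^sup>2"
      using norm_triangle_sub[of "s * e s * deriv (\<lambda>s. fst (snd (W s))) s - \<mu> * fst (snd (W s))"
         "snd (snd (W s))"] by (simp add: algebra_simps)
  qed
  have W1: "norm (fst (W s)) \<le> C * (B + C * (B + C * B)) * (norm s)\<^sup>2" if s: "s \<in> ball 0 r" for s
  proof (rule est[OF D(1-3) _ _ _ _ s])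
    fix s :: complex assume s: "s \<in> ball 0 r"
    from order_trans[OF norm_fst_le' bd[OF this]]
    have "norm ((s * e s * deriv (\<lambda>s. fst (W s)) s - \<mu> * fst (W s)) - fst (snd (W s)))
        \<le> B * (norm s)\<^sup>2"
      by (simp add: cscale_def cderiv3_def jblock_def algebra_simps)
    with W2[OF s] show "norm (s * e s * deriv (\<lambda>s. fst (W s)) s - \<mu> * fst (W s))
        \<le> (B + C * (B + C * B)) * (norm s)\<^sup>2"
      using norm_triangle_sub[of "s * e s * deriv (\<lambda>s. fst (W s)) s - \<mu> * fst (W s)"
         "fst (snd (W s))"] by (simp add: algebra_simps)
  qed
  have "norm (W s) \<le> norm (fst (W s)) + norm (fst (snd (W s))) + norm (snd (snd (W s)))"
    by (rule norm_c3_le_sum)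
  also have "\<dots> \<le> C * (B + C * (B + C * B)) * (norm s)\<^sup>2 + C * (B + C * B) * (norm s)\<^sup>2
      + C * B * (norm s)\<^sup>2"
    by (intro add_mono W1 W2 W3 s)
  also have "\<dots> = jconst C * B * (norm s)\<^sup>2" by (simp add: jconst_def algebra_simps)
  finally show ?thesis by (simp add: C_def)
qed

text \<open>With \<open>v = s\<^sup>2 q\<close>, the substitution \<open>W = s \<Psi>\<close>
  reduces the equation to \<open>\<Psi>' = q / \<mu>\<close>. The primitive with
  \<open>\<Psi> 0 = 0\<close> is the one for which \<open>W\<close> has no linear term.\<close>

lemma euler_solve:
  fixes v :: "complex \<Rightarrow> complex"
  assumes "v holomorphic_on ball 0 r" "v 0 = 0" "deriv v 0 = 0" "\<mu> \<noteq> 0" "r > 0"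
  obtains W where "W holomorphic_on ball 0 r" "W 0 = 0" "deriv W 0 = 0"
    "\<And>s. s \<in> ball 0 r \<Longrightarrow> \<mu> * s * deriv W s = \<mu> * W s + v s"
proof -
  obtain q where q: "q holomorphic_on ball 0 r" "\<And>s. v s = s\<^sup>2 * q s"
    using holomorphic_factor_double_zero[OF assms(1-3)] by blast
  have "(\<lambda>s. q s / \<mu>) holomorphic_on ball 0 r"
    using assms by (intro holomorphic_intros q) auto
  then obtain \<Psi> where P: "\<And>s. s \<in> ball 0 r \<Longrightarrow> (\<Psi> has_field_derivative q s / \<mu>) (at s)"
    "\<Psi> holomorphic_on ball 0 r" "\<Psi> 0 = 0"
    using holomorphic_primitive_ball by blast
  have d: "deriv (\<lambda>s. s * \<Psi> s) s = \<Psi> s + s * (q s / \<mu>)" if "s \<in> ball 0 r" for s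
    by (rule DERIV_imp_deriv) (rule derivative_eq_intros refl P(1)[OF that] | simp)+
  show ?thesis
  proof (rule that)
    show "(\<lambda>s. s * \<Psi> s) holomorphic_on ball 0 r" by (intro holomorphic_intros P)
    show "deriv (\<lambda>s. s * \<Psi> s) 0 = 0" using d[of 0] P(3) \<open>r > 0\<close> by simp
    show "\<mu> * s * deriv (\<lambda>s. s * \<Psi> s) s = \<mu> * (s * \<Psi> s) + v s" if "s \<in> ball 0 r" for s
      unfolding d[OF that] using \<open>\<mu> \<noteq> 0\<close> by (simp add: q(2) field_simps power2_eq_square)
  qed simp
qed

text \<open>Solved from the last component upwards, each solution joining the source term of the
  next scalar equation.\<close>

lemma jordan_solve:
  assumes V: "flat_curve r V" and "\<mu> \<noteq> 0" "r > 0"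
  obtains W where "flat_curve r W"
    "\<And>s. s \<in> ball 0 r \<Longrightarrow> cscale (\<mu> * s) (cderiv3 W s) = jblock \<mu> (W s) + V s"
proof -
  note D = flat_curveD[OF V]
  obtain c where c: "c holomorphic_on ball 0 r" "c 0 = 0" "deriv c 0 = 0"
    "\<And>s. s \<in> ball 0 r \<Longrightarrow> \<mu> * s * deriv c s = \<mu> * c s + snd (snd (V s))"
    using euler_solve[OF D(7-9) assms(2,3)] by blast
  have "(\<lambda>s. c s + fst (snd (V s))) holomorphic_on ball 0 r" "c 0 + fst (snd (V 0)) = 0"
    "deriv (\<lambda>s. c s + fst (snd (V s))) 0 = 0"
    using c D assms(3) by (auto intro!: holomorphic_intros simp: deriv_add holomorphic_on_imp_differentiable_at)
  from euler_solve[OF this assms(2,3)]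
  obtain b where b: "b holomorphic_on ball 0 r" "b 0 = 0" "deriv b 0 = 0"
    "\<And>s. s \<in> ball 0 r \<Longrightarrow> \<mu> * s * deriv b s = \<mu> * b s + (c s + fst (snd (V s)))"
    by blast
  have "(\<lambda>s. b s + fst (V s)) holomorphic_on ball 0 r" "b 0 + fst (V 0) = 0"
    "deriv (\<lambda>s. b s + fst (V s)) 0 = 0"
    using b D assms(3) by (auto intro!: holomorphic_intros simp: deriv_add holomorphic_on_imp_differentiable_at)
  from euler_solve[OF this assms(2,3)]
  obtain a where a: "a holomorphic_on ball 0 r" "a 0 = 0" "deriv a 0 = 0"
    "\<And>s. s \<in> ball 0 r \<Longrightarrow> \<mu> * s * deriv a s = \<mu> * a s + (b s + fst (V s))"
    by blast
  show ?thesis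
  proof (rule that)
    show "flat_curve r (\<lambda>s. (a s, b s, c s))"
      using a b c by (simp add: flat_curve_def hcurve_def cderiv3_def zero_prod_def)
    show "cscale (\<mu> * s) (cderiv3 (\<lambda>s. (a s, b s, c s)) s) = jblock \<mu> (a s, b s, c s) + V s"
      if "s \<in> ball 0 r" for s
      using a(4)[OF that] b(4)[OF that] c(4)[OF that]
      by (cases "V s") (simp add: cscale_def cderiv3_def jblock_def)
  qed
qed

text \<open>The quotient by \<open>s\<^sup>2\<close> may be unbounded near the edge of the disc, so
  a bound is claimed on a smaller disc, whose closure is compact.\<close>

lemma flat_curve_bound:
  assumes "flat_curve r V" "r' < r"
  shows "\<exists>B\<ge>0. \<forall>s\<in>ball 0 r'. norm (V s) \<le> B * (norm s)\<^sup>2"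
proof -
  note D = flat_curveD[OF assms(1)]
  have scalar: "\<exists>B\<ge>0. \<forall>s\<in>ball 0 r'. norm (v s) \<le> B * (norm s)\<^sup>2"
    if v: "v holomorphic_on ball 0 r" "v 0 = 0" "deriv v 0 = 0" for v :: "complex \<Rightarrow> complex"
  proof -
    obtain q where q: "q holomorphic_on ball 0 r" "\<And>s. v s = s\<^sup>2 * q s"
      using holomorphic_factor_double_zero[OF v] by blast
    have "continuous_on (cball 0 r') q"
      using assms(2)
      by (intro continuous_on_subset[OF holomorphic_on_imp_continuous_on[OF q(1)]]) auto
    then have "bounded (q ` cball 0 r')"
      by (intro compact_imp_bounded compact_continuous_image) auto
    then obtain b where b: "b > 0" "\<And>s. s \<in> cball 0 r' \<Longrightarrow> norm (q s) \<le> b"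
      unfolding bounded_pos by auto
    have "norm (v s) \<le> b * (norm s)\<^sup>2" if "s \<in> ball 0 r'" for s
      using b(2)[of s] that by (simp add: q(2) norm_mult norm_power mult.commute mult_right_mono)
    then show ?thesis using b(1) by (intro exI[of _ b]) auto
  qed
  obtain B1 where B1: "B1 \<ge> 0" "\<forall>s\<in>ball 0 r'. norm (fst (V s)) \<le> B1 * (norm s)\<^sup>2"
    using scalar[OF D(1-3)] by blast
  obtain B2 where B2: "B2 \<ge> 0" "\<forall>s\<in>ball 0 r'. norm (fst (snd (V s))) \<le> B2 * (norm s)\<^sup>2"
    using scalar[OF D(4-6)] by blast
  obtain B3 where B3: "B3 \<ge> 0" "\<forall>s\<in>ball 0 r'. norm (snd (snd (V s))) \<le> B3 * (norm s)\<^sup>2"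
    using scalar[OF D(7-9)] by blast
  have "norm (V s) \<le> (B1 + B2 + B3) * (norm s)\<^sup>2" if "s \<in> ball 0 r'" for s
    using norm_c3_le_sum[of "V s"] B1(2)[rule_format, OF that] B2(2)[rule_format, OF that]
      B3(2)[rule_format, OF that] by (simp add: distrib_right)
  then show ?thesis using B1 B2 B3 by (intro exI[of _ "B1 + B2 + B3"]) auto
qed

lemma flat_curve_diff:
  assumes "flat_curve r \<gamma>" "flat_curve r \<eta>" "r > 0"
  shows "flat_curve r (\<lambda>s. \<gamma> s - \<eta> s)"
  using assms hcurve_diff[of "ball 0 r" \<gamma> \<eta>] by (simp add: flat_curve_def)

lemma jblock_diff: "jblock \<mu> (p - q) = jblock \<mu> p - jblock \<mu> q"
  by (simp add: jblock_def algebra_simps)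

lemma jblock_add: "jblock \<mu> (p + q) = jblock \<mu> p + jblock \<mu> q"
  by (simp add: jblock_def algebra_simps)

text \<open>Weierstrass' theorem in each component. Convergence of the derivatives is what allows
  the differential equation to pass to the limit.\<close>

lemma hcurve_uniform_limit:
  assumes "open B" "\<And>n. hcurve B (W n)" "uniform_limit B W w sequentially"
  shows "hcurve B w" and "s \<in> B \<Longrightarrow> (\<lambda>n. cderiv3 (W n) s) \<longlonglongrightarrow> cderiv3 w s"
proof -
  have scalar: "\<exists>v'. \<forall>s\<in>B. (v has_field_derivative v' s) (at s) \<and> (\<lambda>n. deriv (V n) s) \<longlonglongrightarrow> v' s"
    if V: "\<And>n. V n holomorphic_on B" "uniform_limit B V v sequentially" 
    for V and v :: "complex \<Rightarrow> complex"
  proof (rule has_complex_derivative_uniform_sequence[OF assms(1)])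
    show "(V n has_field_derivative deriv (V n) s) (at s)" if "s \<in> B" for n s
      using holomorphic_derivI[OF V(1) assms(1) that] .
    show "\<exists>d>0. cball s d \<subseteq> B \<and> uniform_limit (cball s d) V v sequentially" if s: "s \<in> B" for s
    proof -
      obtain d where d: "d > 0" "cball s d \<subseteq> B" using assms(1) s open_contains_cball by blast
      then show ?thesis using uniform_limit_on_subset[OF V(2)] by blast
    qed
  qed
  have H: "\<And>n. (\<lambda>s. fst (W n s)) holomorphic_on B" "\<And>n. (\<lambda>s. fst (snd (W n s))) holomorphic_on B"
    "\<And>n. (\<lambda>s. snd (snd (W n s))) holomorphic_on B"
    using assms(2) unfolding hcurve_def by auto
  note u1 = bounded_linear_fst[THEN bounded_linear.uniform_limit, OF assms(3)]
  note u23 = bounded_linear_snd[THEN bounded_linear.uniform_limit, OF assms(3)]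
  note u2 = bounded_linear_fst[THEN bounded_linear.uniform_limit, OF u23]
  note u3 = bounded_linear_snd[THEN bounded_linear.uniform_limit, OF u23]
  obtain a where a: "\<forall>s\<in>B. ((\<lambda>s. fst (w s)) has_field_derivative a s) (at s) \<and>
      (\<lambda>n. deriv (\<lambda>s. fst (W n s)) s) \<longlonglongrightarrow> a s"
    using scalar[OF H(1) u1] by auto
  obtain b where b: "\<forall>s\<in>B. ((\<lambda>s. fst (snd (w s))) has_field_derivative b s) (at s) \<and>
      (\<lambda>n. deriv (\<lambda>s. fst (snd (W n s))) s) \<longlonglongrightarrow> b s"
    using scalar[OF H(2) u2] by auto
  obtain c where c: "\<forall>s\<in>B. ((\<lambda>s. snd (snd (w s))) has_field_derivative c s) (at s) \<and>
      (\<lambda>n. deriv (\<lambda>s. snd (snd (W n s))) s) \<longlonglongrightarrow> c s"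
    using scalar[OF H(3) u3] by auto
  show "hcurve B w"
    unfolding hcurve_def holomorphic_on_open[OF assms(1)] using a b c by blast
  show "(\<lambda>n. cderiv3 (W n) s) \<longlonglongrightarrow> cderiv3 w s" if "s \<in> B"
    unfolding cderiv3_def
    using a[rule_format, OF that] b[rule_format, OF that] c[rule_format, OF that]
    by (auto intro!: tendsto_Pair simp: DERIV_imp_deriv)
qed

section \<open>The invariant curve\<close>

text \<open>The nonlinearity enters through three facts: a small Lipschitz constant near 0,
  holomorphy along holomorphic curves, and no first-order term along curves through 0. Its
  differentiability is expressed along curves because it is differentiated only there.\<close>

locale jordan_field =
  fixes \<mu> :: complex and G :: "c3 \<Rightarrow> c3"
  assumes mu: "\<mu> \<noteq> 0" and G0: "G 0 = 0"
    and G_small: "\<And>\<epsilon>. \<epsilon> > 0 \<Longrightarrow> \<exists>\<rho>>0.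
        (\<forall>p\<in>ball 0 \<rho>. \<forall>q\<in>ball 0 \<rho>. norm (G p - G q) \<le> \<epsilon> * norm (p - q)) \<and>
        (\<forall>B \<gamma>. open B \<longrightarrow> hcurve B \<gamma> \<longrightarrow> \<gamma> ` B \<subseteq> ball 0 \<rho> \<longrightarrow> hcurve B (\<lambda>s. G (\<gamma> s)))"
    and G_flat: "\<And>B \<gamma>. hcurve B \<gamma> \<Longrightarrow> open B \<Longrightarrow> 0 \<in> B \<Longrightarrow> \<gamma> 0 = 0 \<Longrightarrow>
        cderiv3 (\<lambda>s. G (\<gamma> s)) 0 = 0"
begin

definition field :: "c3 \<Rightarrow> c3" where "field p = jblock \<mu> p + G p"

text \<open>Picard iteration for the remainder \<open>w\<close> in \<open>u = ax + w\<close>. The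
  linear equation is solved by \<open>jordan_solve\<close>, and \<open>jordan_estimate\<close>
  supplies the bound on its inverse.\<close>

lemma invariant_curve_exists:
  obtains r u where "r > 0" "hcurve (ball 0 r) u" "u 0 = 0" "cderiv3 u 0 = x_axis"
    "\<And>s. s \<in> ball 0 r \<Longrightarrow> cscale (\<mu> * s) (cderiv3 u s) = field (u s)"
proof -
  \<comment> \<open>The estimate is used with \<open>e = \<mu>\<close> and
    \<open>\<tau> = 1\<close>, hence \<open>m = norm \<mu>\<close> and \<open>m' = 1\<close>;
    \<epsilon> is then chosen so that the contraction factor \<open>K * \<epsilon>\<close> is one
    half.\<close>
  define K where "K = jconst (1 / norm \<mu>)"
  have K: "K > 0" using mu unfolding K_def by (intro jconst_pos) simp
  define \<epsilon> where "\<epsilon> = 1 / (2 * K)"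
  have \<epsilon>: "\<epsilon> > 0" "K * \<epsilon> = 1 / 2" using K by (auto simp: \<epsilon>_def)
  obtain \<rho> where \<rho>: "\<rho> > 0"
    and lip: "\<And>p q. p \<in> ball 0 \<rho> \<Longrightarrow> q \<in> ball 0 \<rho> \<Longrightarrow> norm (G p - G q) \<le> \<epsilon> * norm (p - q)"
    and comp: "\<And>B \<gamma>. open B \<Longrightarrow> hcurve B \<gamma> \<Longrightarrow> \<gamma> ` B \<subseteq> ball 0 \<rho> \<Longrightarrow> hcurve B (\<lambda>s. G (\<gamma> s))"
    using G_small[OF \<epsilon>(1)] by blast
  define ax :: "complex \<Rightarrow> c3" where "ax s = (s, 0, 0)" for s
  have ax: "hcurve UNIV ax" "\<And>s. cderiv3 ax s = x_axis" "\<And>s. norm (ax s) = norm s" "ax 0 = 0"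
    by (auto simp: hcurve_def ax_def cderiv3_def x_axis_def norm_Pair zero_prod_def
        intro!: holomorphic_intros)
  have "flat_curve \<rho> (\<lambda>s. G (ax s))"
    unfolding flat_curve_def
    using comp[of "ball 0 \<rho>" ax] hcurve_subset[OF ax(1), of "ball 0 \<rho>"]
      G_flat[OF ax(1)] ax(3,4) G0 by (auto simp: image_subset_iff)
  \<comment> \<open>\<open>B0\<close> measures how far the straight axis is from being
    invariant.\<close>
  from flat_curve_bound[OF this, of "\<rho>/2"] \<rho> obtain B0 where B0: "B0 \<ge> 0" "\<And>s. s \<in> ball 0 (\<rho>/2) \<Longrightarrow> norm (G (ax s)) \<le> B0 * (norm s)\<^sup>2"
    by (auto simp del: mem_ball)
  \<comment> \<open>The first iterate has weighted norm at most \<open>M\<close>, and the ball of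
    radius \<open>2 * M\<close> maps into itself because
    \<open>K * (B0 + \<epsilon> * (2 * M)) = M + M\<close>.\<close>
  define M where "M = K * B0"
  have M: "M \<ge> 0" using K B0 by (simp add: M_def)
  \<comment> \<open>\<open>r \<le> 1\<close> gives \<open>(norm s)\<^sup>2 \<le> norm s\<close>, so
    that \<open>norm (ax s + w s) \<le> r * (1 + 2 * M)\<close>, which stays within the Lipschitz
    ball.\<close>
  define r where "r = min (\<rho>/2) 1 / (1 + 2 * M)"
  have rM: "r * (1 + 2 * M) = min (\<rho>/2) 1" using M by (simp add: r_def)
  have "r \<le> r * (1 + 2 * M)" if "r > 0" using that M by simp
  then have r: "r > 0" "r \<le> 1" "r \<le> \<rho>/2" "r * (1 + 2 * M) \<le> \<rho>/2"
    using rM \<rho> M by (auto simp: r_def)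
  have inball: "ax s + p \<in> ball 0 \<rho>" if s: "s \<in> ball 0 r" and p: "norm p \<le> 2 * M * (norm s)\<^sup>2" for s p
  proof -
    have "norm (ax s + p) \<le> norm s + 2 * M * (norm s)\<^sup>2"
      using norm_triangle_ineq[of "ax s" p] p ax(3)[of s] by simp
    also have "(norm s)\<^sup>2 \<le> norm s"
      using s r by (simp add: power2_eq_square mult_left_le)
    then have "norm s + 2 * M * (norm s)\<^sup>2 \<le> norm s * (1 + 2 * M)"
      using M by (simp add: distrib_left mult_left_mono mult.commute)
    also have "\<dots> \<le> r * (1 + 2 * M)" using s M by (intro mult_right_mono) auto
    finally show ?thesis using r \<rho> by simp
  qed
  define X where "X = {w. flat_curve r w \<and> (\<forall>s\<in>ball 0 r. norm (w s) \<le> 2 * M * (norm s)\<^sup>2)}"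
  \<comment> \<open>The nonlinearity is frozen at \<open>w\<close> and the linear equation is solved
    for \<open>w'\<close>; a fixed point makes \<open>ax + w\<close> invariant.\<close>
  define E where "E w w' \<longleftrightarrow> (\<forall>s\<in>ball 0 r. cscale (\<mu> * s) (cderiv3 w' s) = jblock \<mu> (w' s) + G (ax s + w s))"
    for w w'
  have est: "norm (W s) \<le> K * B * (norm s)\<^sup>2"
    if "flat_curve r W" "\<And>s. s \<in> ball 0 r \<Longrightarrow>
       norm (cscale (\<mu> * s) (cderiv3 W s) - jblock \<mu> (W s)) \<le> B * (norm s)\<^sup>2" "s \<in> ball 0 r"
    for W B s
    unfolding K_def
    by (rule jordan_estimate[where \<tau>="\<lambda>_. 1" and e="\<lambda>_. \<mu>", OF _ _ that(1)])
       (use mu that in \<open>auto simp: mult.commute\<close>)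
  have step: "\<exists>w'. w' \<in> X \<and> E w w'" if "w \<in> X" for w
  proof -
    have w: "flat_curve r w" "\<And>s. s \<in> ball 0 r \<Longrightarrow> norm (w s) \<le> 2 * M * (norm s)\<^sup>2"
      using that by (auto simp: X_def)
    have h: "hcurve (ball 0 r) (\<lambda>s. ax s + w s)"
      using hcurve_add(1)[OF hcurve_subset[OF ax(1)], of "ball 0 r" w] w(1)
      by (simp add: flat_curve_def)
    have "(\<lambda>s. ax s + w s) ` ball 0 r \<subseteq> ball 0 \<rho>" using inball w(2) by blast
    then have "flat_curve r (\<lambda>s. G (ax s + w s))"
      using comp[OF _ h] G_flat[OF h] w(1) G0 ax(4) r(1) by (simp add: flat_curve_def)
    then obtain w' where w': "flat_curve r w'"
      "\<And>s. s \<in> ball 0 r \<Longrightarrow> cscale (\<mu> * s) (cderiv3 w' s) = jblock \<mu> (w' s) + G (ax s + w s)"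
      using jordan_solve[OF _ mu r(1)] by blast
    have "norm (w' s) \<le> K * (B0 + \<epsilon> * (2 * M)) * (norm s)\<^sup>2" if s: "s \<in> ball 0 r" for s
    proof (rule est[OF w'(1) _ s])
      fix s :: complex assume s: "s \<in> ball 0 r"
      have "norm (G (ax s + w s) - G (ax s)) \<le> \<epsilon> * norm (w s)"
        using lip[OF inball[OF s w(2)[OF s]] inball[OF s, of 0]] M by simp
      also have "\<dots> \<le> \<epsilon> * (2 * M * (norm s)\<^sup>2)"
        using w(2)[OF s] \<epsilon> by (intro mult_left_mono) auto
      finally have "norm (G (ax s + w s)) \<le> B0 * (norm s)\<^sup>2 + \<epsilon> * (2 * M * (norm s)\<^sup>2)"
        using B0(2)[of s] s r norm_triangle_sub[of "G (ax s + w s)" "G (ax s)"] by simp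
      then show "norm (cscale (\<mu> * s) (cderiv3 w' s) - jblock \<mu> (w' s)) \<le> (B0 + \<epsilon> * (2 * M)) * (norm s)\<^sup>2"
        using w'(2)[OF s] by (simp add: algebra_simps)
    qed
    moreover have "K * (B0 + \<epsilon> * (2 * M)) = M + (K * \<epsilon>) * (2 * M)" by (simp add: M_def algebra_simps)
    then have "K * (B0 + \<epsilon> * (2 * M)) = 2 * M" using \<epsilon>(2) by simp
    ultimately have "w' \<in> X" using w'(1) by (simp add: X_def)
    then show ?thesis using w'(2) by (auto simp: E_def)
  qed
  then obtain T where T: "\<And>w. w \<in> X \<Longrightarrow> T w \<in> X" "\<And>w. w \<in> X \<Longrightarrow> E w (T w)" by metis
  \<comment> \<open>The difference of two images solves the linear equation with source
    \<open>G (ax s + w s) - G (ax s + v s)\<close>, whence the factor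
    \<open>K * \<epsilon> = 1/2\<close>.\<close>
  have contr: "norm (T w s - T v s) \<le> B / 2 * (norm s)\<^sup>2"
    if w: "w \<in> X" and v: "v \<in> X" and wv: "\<And>s. s \<in> ball 0 r \<Longrightarrow> norm (w s - v s) \<le> B * (norm s)\<^sup>2"
      and s: "s \<in> ball 0 r" for w v B s
  proof -
    have fl: "flat_curve r (T w)" "flat_curve r (T v)" using T(1) w v by (auto simp: X_def)
    have "norm (T w s - T v s) \<le> K * (\<epsilon> * B) * (norm s)\<^sup>2"
    proof (rule est[OF flat_curve_diff[OF fl r(1)] _ s])
      fix s :: complex assume s: "s \<in> ball 0 r"
      have "cderiv3 (\<lambda>s. T w s - T v s) s = cderiv3 (T w) s - cderiv3 (T v) s"
        using hcurve_diff(2)[of "ball 0 r" "T w" "T v" s] fl s by (simp add: flat_curve_def)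
      then have "cscale (\<mu> * s) (cderiv3 (\<lambda>s. T w s - T v s) s) - jblock \<mu> (T w s - T v s)
          = G (ax s + w s) - G (ax s + v s)"
        using T(2)[OF w] T(2)[OF v] s by (simp add: E_def cscale_diff jblock_diff)
      moreover have "norm (G (ax s + w s) - G (ax s + v s)) \<le> \<epsilon> * norm (w s - v s)"
        using lip[OF inball[OF s, of "w s"] inball[OF s, of "v s"]] w v s by (simp add: X_def)
      moreover have "\<epsilon> * norm (w s - v s) \<le> \<epsilon> * (B * (norm s)\<^sup>2)"
        using wv[OF s] \<epsilon>(1) by simp
      ultimately show "norm (cscale (\<mu> * s) (cderiv3 (\<lambda>s. T w s - T v s) s) - jblock \<mu> (T w s - T v s))
          \<le> \<epsilon> * B * (norm s)\<^sup>2" by simp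
    qed
    also have "K * (\<epsilon> * B) = B / 2" using \<epsilon>(2) by (simp flip: mult.assoc)
    finally show ?thesis .
  qed
  define W where "W n = (T ^^ n) (\<lambda>_. 0)" for n
  have W0: "W 0 = (\<lambda>_. 0)" and WS: "W (Suc n) = T (W n)" for n by (auto simp: W_def)
  have "(\<lambda>_. 0) \<in> X"
    using M by (simp add: X_def flat_curve_def hcurve_def cderiv3_def zero_prod_def)
  then have WX: "W n \<in> X" for n by (induction n) (auto simp: W0 WS T)
  have diff: "norm (W (Suc n) s - W n s) \<le> 2 * M * (1/2)^n * (norm s)\<^sup>2" if "s \<in> ball 0 r" for n s
    using that
  proof (induction n arbitrary: s)
    case 0 then show ?case using WX[of 1] by (simp add: X_def W0)
  next
    case (Suc n)
    then show ?case using contr[OF WX WX, of "Suc n" n "2 * M * (1/2)^n"] by (simp add: WS)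
  qed
  \<comment> \<open>The iterates are partial sums of a telescoping series dominated by a geometric
    one, so the Weierstrass test yields the limit without a Banach space of curves.\<close>
  have "uniform_limit (ball 0 r) (\<lambda>n s. \<Sum>i<n. W (Suc i) s - W i s)
      (\<lambda>s. suminf (\<lambda>i. W (Suc i) s - W i s)) sequentially"
  proof (rule Weierstrass_m_test)
    show "norm (W (Suc n) s - W n s) \<le> 2 * M * (1/2)^n" if s: "s \<in> ball 0 r" for n s
    proof -
      have "norm s ^ 2 \<le> 1" using s r by (intro power_le_one) auto
      then have "2 * M * (1/2)^n * (norm s)\<^sup>2 \<le> 2 * M * (1/2)^n"
        using M by (intro mult_left_le) auto
      then show ?thesis using diff[OF s, of n] by simp
    qed
    show "summable (\<lambda>n. 2 * M * (1/2)^n)" by (intro summable_mult summable_geometric) simp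
  qed
  moreover have "(\<Sum>i<n. W (Suc i) s - W i s) = W n s" for n s
    using sum_lessThan_telescope[of "\<lambda>i. W i s" n] by (simp add: W0)
  ultimately obtain w where ul: "uniform_limit (ball 0 r) W w sequentially"
    by auto
  have lim: "(\<lambda>n. W n s) \<longlonglongrightarrow> w s" if "s \<in> ball 0 r" for s
    using tendsto_uniform_limitI[OF ul that] .
  have hW: "hcurve (ball 0 r) (W n)" "W n 0 = 0" "cderiv3 (W n) 0 = 0" for n
    using WX[of n] by (auto simp: X_def flat_curve_def)
  note hw = hcurve_uniform_limit[OF open_ball hW(1) ul]
  have w0: "w 0 = 0" "cderiv3 w 0 = 0"
    using lim[of 0] hw(2)[of 0] r(1) by (auto simp: hW LIMSEQ_const_iff)
  have wb: "norm (w s) \<le> 2 * M * (norm s)\<^sup>2" if "s \<in> ball 0 r" for s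
    using tendsto_upperbound[OF tendsto_norm[OF lim[OF that]], of "2 * M * (norm s)\<^sup>2"] WX that
    by (auto simp: X_def)
  \<comment> \<open>Both sides of \<open>E (W n) (W (Suc n))\<close> converge: the left through the
    derivatives, the right through the Lipschitz bound on \<open>G\<close>.\<close>
  have eq: "cscale (\<mu> * s) (cderiv3 w s) = jblock \<mu> (w s) + G (ax s + w s)" if s: "s \<in> ball 0 r" for s
  proof (rule LIMSEQ_unique)
    show "(\<lambda>n. cscale (\<mu> * s) (cderiv3 (W (Suc n)) s)) \<longlonglongrightarrow> cscale (\<mu> * s) (cderiv3 w s)"
      unfolding cscale_def by (intro tendsto_intros LIMSEQ_Suc[OF hw(2)[OF s]])
    have "(\<lambda>n. G (ax s + W n s)) \<longlonglongrightarrow> G (ax s + w s)"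
    proof (rule LIM_zero_cancel, rule Lim_null_comparison)
      show "\<forall>\<^sub>F n in sequentially. norm (G (ax s + W n s) - G (ax s + w s)) \<le> \<epsilon> * norm (W n s - w s)"
      proof (intro always_eventually allI)
        fix n
        show "norm (G (ax s + W n s) - G (ax s + w s)) \<le> \<epsilon> * norm (W n s - w s)"
          using lip[OF inball[OF s, of "W n s"] inball[OF s wb[OF s]]] WX[of n] s by (simp add: X_def)
      qed
      show "(\<lambda>n. \<epsilon> * norm (W n s - w s)) \<longlonglongrightarrow> 0"
        using tendsto_mult_right_zero[OF tendsto_norm_zero[OF LIM_zero[OF lim[OF s]]]] .
    qed
    then have "(\<lambda>n. jblock \<mu> (W (Suc n) s) + G (ax s + W n s)) \<longlonglongrightarrow> jblock \<mu> (w s) + G (ax s + w s)"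
      unfolding jblock_def by (intro tendsto_intros LIMSEQ_Suc[OF lim[OF s]])
    then show "(\<lambda>n. cscale (\<mu> * s) (cderiv3 (W (Suc n)) s)) \<longlonglongrightarrow> jblock \<mu> (w s) + G (ax s + w s)"
      using T(2)[OF WX] s by (simp add: E_def WS)
  qed
  have hax: "hcurve (ball 0 r) ax" using hcurve_subset[OF ax(1)] by simp
  note hu = hcurve_add[OF hax hw(1) open_ball]
  show ?thesis
  proof (rule that[OF r(1) hu(1)])
    show "ax 0 + w 0 = 0" using ax(4) w0 by simp
    show "cderiv3 (\<lambda>s. ax s + w s) 0 = x_axis" using hu(2)[of 0] r(1) w0 ax(2) by simp
    show "cscale (\<mu> * s) (cderiv3 (\<lambda>s. ax s + w s) s) = field (ax s + w s)" if "s \<in> ball 0 r" for s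
      using hu(2)[OF that] eq[OF that]
      by (simp add: cscale_add ax(2) field_def jblock_add) (simp add: jblock_def ax_def cscale_def x_axis_def)
  qed
qed

end

section \<open>Local tools and tangent directions of invariant curves\<close>

lemma isCont_eventually_in:
  assumes "isCont g a" "open S" "g a \<in> S"
  shows "\<forall>\<^sub>F x in nhds a. g x \<in> S"
  using assms by (simp add: isCont_def tendsto_at_iff_tendsto_nhds topological_tendstoD)

lemma holomorphic_isCont_0: "f holomorphic_on ball 0 R \<Longrightarrow> R > 0 \<Longrightarrow> isCont f 0"
  using holomorphic_on_imp_continuous_on[of f "ball 0 R"]
  by (simp add: continuous_on_eq_continuous_at)

lemma eventually_nhds_0_ball:
  fixes P :: "complex \<Rightarrow> bool"
  assumes "\<forall>\<^sub>F s in nhds 0. P s"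
  obtains d where "d > 0" "\<And>s. s \<in> ball 0 d \<Longrightarrow> P s"
  using assms unfolding eventually_nhds_metric by auto

lemma bounded_linear_jblock: "bounded_linear (jblock \<mu>)"
  unfolding linear_conv_bounded_linear[symmetric]
  by (auto intro!: linearI simp: jblock_def scaleR_conv_of_real algebra_simps)

lemma jblock_cscale: "jblock \<mu> (cscale \<zeta> v) = cscale \<zeta> (jblock \<mu> v)"
  by (simp add: jblock_def cscale_def algebra_simps)

lemma hcurve_jblock:
  assumes "hcurve B \<gamma>" "open B"
  shows "hcurve B (\<lambda>s. jblock \<mu> (\<gamma> s))"
    and "s \<in> B \<Longrightarrow> cderiv3 (\<lambda>s. jblock \<mu> (\<gamma> s)) s = jblock \<mu> (cderiv3 \<gamma> s)"
proof -
  have d: "((\<lambda>s. jblock \<mu> (\<gamma> s)) has_derivative (\<lambda>\<zeta>. cscale \<zeta> (jblock \<mu> (cderiv3 \<gamma> s)))) (at s)"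
    if "s \<in> B" for s
    using bounded_linear.has_derivative[OF bounded_linear_jblock hcurve_has_derivative[OF assms that]]
    by (simp add: jblock_cscale)
  show "hcurve B (\<lambda>s. jblock \<mu> (\<gamma> s))" using hcurveI[OF assms(2) d] .
  show "s \<in> B \<Longrightarrow> cderiv3 (\<lambda>s. jblock \<mu> (\<gamma> s)) s = jblock \<mu> (cderiv3 \<gamma> s)"
    using has_derivative_cscaleD(4)[OF d] .
qed

text \<open>Differentiate the relation at 0: since \<open>A\<close> and \<open>B\<close> vanish
  there, the terms containing derivatives of \<open>a\<close> and \<open>b\<close> drop out.\<close>

lemma proportional_deriv_0:
  fixes A B a b :: "complex \<Rightarrow> complex"
  assumes "A holomorphic_on ball 0 R" "B holomorphic_on ball 0 R"
    "a holomorphic_on ball 0 R" "b holomorphic_on ball 0 R" "R > 0" "A 0 = 0" "B 0 = 0"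
    and eq: "\<And>s. s \<in> ball 0 R \<Longrightarrow> A s * b s = B s * a s"
  shows "deriv A 0 * b 0 = deriv B 0 * a 0"
proof -
  have 0: "0 \<in> ball (0::complex) R" using assms by simp
  note d = holomorphic_derivI[OF _ open_ball 0]
  have "((\<lambda>s. A s * b s) has_field_derivative deriv A 0 * b 0) (at 0)"
    using DERIV_mult[OF d[OF assms(1)] d[OF assms(4)]] assms(6) by (simp add: mult.commute)
  moreover have "((\<lambda>s. B s * a s) has_field_derivative deriv B 0 * a 0) (at 0)"
    using DERIV_mult[OF d[OF assms(2)] d[OF assms(3)]] assms(7) by (simp add: mult.commute)
  then have "((\<lambda>s. A s * b s) has_field_derivative deriv B 0 * a 0) (at 0)"
    by (rule has_field_derivative_transform_within_open[OF _ open_ball 0]) (simp add: eq)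
  ultimately show ?thesis using DERIV_unique by blast
qed

context jordan_field
begin

lemma hcurve_field:
  assumes "hcurve (ball 0 R) \<gamma>" "R > 0" "\<gamma> 0 = 0"
  obtains R' where "R' > 0" "R' \<le> R" "hcurve (ball 0 R') (\<lambda>s. field (\<gamma> s))"
    "cderiv3 (\<lambda>s. field (\<gamma> s)) 0 = jblock \<mu> (cderiv3 \<gamma> 0)"
proof -
  obtain \<rho> where \<rho>: "\<rho> > 0"
    and comp: "\<And>B \<gamma>. open B \<Longrightarrow> hcurve B \<gamma> \<Longrightarrow> \<gamma> ` B \<subseteq> ball 0 \<rho> \<Longrightarrow> hcurve B (\<lambda>s. G (\<gamma> s))"
    using G_small[of 1] by auto
  have "isCont \<gamma> 0" using hcurve_isCont[OF assms(1)] assms(2) by simp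
  from isCont_eventually_in[OF this, of "ball 0 \<rho>"] \<rho> assms(3)
  obtain d where d: "d > 0" "\<And>s. s \<in> ball 0 d \<Longrightarrow> \<gamma> s \<in> ball 0 \<rho>"
    by (auto elim: eventually_nhds_0_ball simp del: mem_ball)
  define R' where "R' = min R d"
  have R': "R' > 0" "R' \<le> R" "\<gamma> ` ball 0 R' \<subseteq> ball 0 \<rho>" using d assms(2) by (auto simp: R'_def)
  have h: "hcurve (ball 0 R') \<gamma>" by (rule hcurve_smaller_ball[OF assms(1) R'(2)])
  note hG = comp[OF open_ball h R'(3)]
  note hJ = hcurve_jblock[OF h open_ball]
  note hF = hcurve_add[OF hJ(1) hG open_ball]
  show ?thesis
  proof (rule that[OF R'(1,2)])
    show "hcurve (ball 0 R') (\<lambda>s. field (\<gamma> s))" using hF(1) by (simp add: field_def)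
    show "cderiv3 (\<lambda>s. field (\<gamma> s)) 0 = jblock \<mu> (cderiv3 \<gamma> 0)"
      using hF(2)[of 0] hJ(2)[of 0] G_flat[OF h] R'(1) assms(3) by (simp add: field_def)
  qed
qed

lemma field_0: "field 0 = 0"
  using G0 by (simp add: field_def jblock_def zero_prod_def)

text \<open>Nothing is known about how the factor \<open>c\<close> depends on \<open>s\<close>, so
  it is eliminated: two minors of the pair of field and velocity vanish identically. Their
  derivatives at 0 are minors of the pair \<open>jblock \<mu> v\<close>, \<open>v\<close>.\<close>

lemma tangent_eigenvector:
  assumes "hcurve (ball 0 R) \<gamma>" "R > 0" "\<gamma> 0 = 0"
    and inv: "\<And>s. s \<in> ball 0 R \<Longrightarrow> \<exists>c. field (\<gamma> s) = cscale c (cderiv3 \<gamma> s)"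
    and v: "cderiv3 \<gamma> 0 = v"
  shows "fst (jblock \<mu> v) * fst (snd v) = fst (snd (jblock \<mu> v)) * fst v"
    and "fst (snd (jblock \<mu> v)) * snd (snd v) = snd (snd (jblock \<mu> v)) * fst (snd v)"
proof -
  obtain R' where R': "R' > 0" "R' \<le> R" and hF: "hcurve (ball 0 R') (\<lambda>s. field (\<gamma> s))"
    and dF: "cderiv3 (\<lambda>s. field (\<gamma> s)) 0 = jblock \<mu> (cderiv3 \<gamma> 0)"
    by (rule hcurve_field[OF assms(1-3)])
  have h: "hcurve (ball 0 R') \<gamma>" by (rule hcurve_smaller_ball[OF assms(1) R'(2)])
  note H = h[unfolded hcurve_def] hF[unfolded hcurve_def]
  have dH: "deriv (\<lambda>s. fst (\<gamma> s)) holomorphic_on ball 0 R'"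
    "deriv (\<lambda>s. fst (snd (\<gamma> s))) holomorphic_on ball 0 R'"
    "deriv (\<lambda>s. snd (snd (\<gamma> s))) holomorphic_on ball 0 R'"
    using H by (auto intro: holomorphic_deriv)
  have z: "field (\<gamma> 0) = 0" using assms(3) field_0 by simp
  have eq: "fst (field (\<gamma> s)) * deriv (\<lambda>s. fst (snd (\<gamma> s))) s
        = fst (snd (field (\<gamma> s))) * deriv (\<lambda>s. fst (\<gamma> s)) s"
    "fst (snd (field (\<gamma> s))) * deriv (\<lambda>s. snd (snd (\<gamma> s))) s
        = snd (snd (field (\<gamma> s))) * deriv (\<lambda>s. fst (snd (\<gamma> s))) s"
    if "s \<in> ball 0 R'" for s
    using inv[of s] that R' by (auto simp: cscale_def cderiv3_def)
  have vv: "deriv (\<lambda>s. fst (\<gamma> s)) 0 = fst v" "deriv (\<lambda>s. fst (snd (\<gamma> s))) 0 = fst (snd v)"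
    "deriv (\<lambda>s. snd (snd (\<gamma> s))) 0 = snd (snd v)"
    and FF: "deriv (\<lambda>s. fst (field (\<gamma> s))) 0 = fst (jblock \<mu> v)"
    "deriv (\<lambda>s. fst (snd (field (\<gamma> s)))) 0 = fst (snd (jblock \<mu> v))"
    "deriv (\<lambda>s. snd (snd (field (\<gamma> s)))) 0 = snd (snd (jblock \<mu> v))"
    using arg_cong[OF v, of fst] arg_cong[OF v, of "fst \<circ> snd"] arg_cong[OF v, of "snd \<circ> snd"]
      arg_cong[OF dF[unfolded v], of fst] arg_cong[OF dF[unfolded v], of "fst \<circ> snd"]
      arg_cong[OF dF[unfolded v], of "snd \<circ> snd"]
    by (simp_all add: cderiv3_def)
  show "fst (jblock \<mu> v) * fst (snd v) = fst (snd (jblock \<mu> v)) * fst v"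
    using proportional_deriv_0[OF _ _ dH(1,2) R'(1) _ _ eq(1)] H z by (simp add: vv FF)
  show "fst (snd (jblock \<mu> v)) * snd (snd v) = snd (snd (jblock \<mu> v)) * fst (snd v)"
    using proportional_deriv_0[OF _ _ dH(2,3) R'(1) _ _ eq(2)] H z by (simp add: vv FF)
qed

text \<open>The invariant field pulls back along \<open>\<gamma>\<close> to \<open>s e(s) \<partial>\<^sub>s\<close> with \<open>e 0 = \<mu>\<close>, which the coordinate
  change \<open>\<psi>\<close> below conjugates to \<open>\<mu> s \<partial>\<^sub>s\<close>. The curves \<open>\<gamma>\<close> and \<open>u \<circ> \<psi>\<close> then solve the
  same equation and agree to first order, so the contraction estimate forces them to coincide.\<close>

lemma invariant_curve_unique:
  assumes u: "r > 0" "hcurve (ball 0 r) u" "u 0 = 0" "cderiv3 u 0 = x_axis"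
    and ueq: "\<And>s. s \<in> ball 0 r \<Longrightarrow> cscale (\<mu> * s) (cderiv3 u s) = field (u s)"
    and \<gamma>: "R > 0" "hcurve (ball 0 R) \<gamma>" "\<gamma> 0 = 0" "cderiv3 \<gamma> 0 = cscale k x_axis" "k \<noteq> 0"
    and inv: "\<And>s. s \<in> ball 0 R \<Longrightarrow> \<exists>c. field (\<gamma> s) = cscale c (cderiv3 \<gamma> s)"
  obtains d \<psi> where "d > 0" "d \<le> R" "\<psi> holomorphic_on ball 0 d" "\<psi> 0 = 0" "deriv \<psi> 0 = k"
    "\<psi> ` ball 0 d \<subseteq> ball 0 r" "\<And>s. s \<in> ball 0 d \<Longrightarrow> \<gamma> s = u (\<psi> s)"
proof -
  obtain R1 where R1: "R1 > 0" "R1 \<le> R" and hF: "hcurve (ball 0 R1) (\<lambda>s. field (\<gamma> s))"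
    and dF: "cderiv3 (\<lambda>s. field (\<gamma> s)) 0 = jblock \<mu> (cderiv3 \<gamma> 0)"
    by (rule hcurve_field[OF \<gamma>(2,1,3)])
  have F0: "fst (field (\<gamma> 0)) = 0" using \<gamma>(3) field_0 by simp
  have dF0: "deriv (\<lambda>s. fst (field (\<gamma> s))) 0 = \<mu> * k"
    using dF unfolding \<gamma>(4) by (simp add: cderiv3_def jblock_def cscale_def x_axis_def)
  obtain p where p: "p holomorphic_on ball 0 R1" "\<And>s. fst (field (\<gamma> s)) = s * p s" "p 0 = \<mu> * k"
    using holomorphic_factor_zero[of "\<lambda>s. fst (field (\<gamma> s))" R1] hF F0 dF0
    unfolding hcurve_def by auto
  define g1 where "g1 = deriv (\<lambda>s. fst (\<gamma> s))"
  have g1: "g1 holomorphic_on ball 0 R1"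
    unfolding g1_def using hcurve_smaller_ball[OF \<gamma>(2) R1(2)]
    by (auto simp: hcurve_def intro!: holomorphic_deriv)
  have g10: "g1 0 = k" using \<gamma>(4) by (simp add: g1_def cderiv3_def cscale_def x_axis_def)
  have cont1: "isCont p 0" "isCont g1 0"
    using p(1) g1 R1(1) holomorphic_isCont_0 by auto
  have "\<forall>\<^sub>F s in nhds 0. p s \<in> - {0} \<and> g1 s \<in> - {0}"
    using p(3) g10 mu \<gamma>(5) by (intro eventually_conj isCont_eventually_in cont1) auto
  then obtain d1 where d1: "d1 > 0" "\<And>s. s \<in> ball 0 d1 \<Longrightarrow> p s \<in> - {0} \<and> g1 s \<in> - {0}"
    by (rule eventually_nhds_0_ball) blast
  define R2 where "R2 = min R1 d1"
  have R2: "R2 > 0" "R2 \<le> R1" "R2 \<le> R" using R1 d1(1) by (auto simp: R2_def)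
  have nz: "p s \<noteq> 0" "g1 s \<noteq> 0" if "s \<in> ball 0 R2" for s
    using d1(2)[of s] that by (auto simp: R2_def)
  have sub2: "ball (0::complex) R2 \<subseteq> ball 0 R1" using R2 by (simp add: subset_ball)
  define e where "e s = p s / g1 s" for s
  have e: "e holomorphic_on ball 0 R2" "e 0 = \<mu>" "\<And>s. s \<in> ball 0 R2 \<Longrightarrow> e s \<noteq> 0"
    using nz p(3) g10 \<gamma>(5) holomorphic_on_subset[OF p(1) sub2] holomorphic_on_subset[OF g1 sub2]
    unfolding e_def by (auto intro!: holomorphic_on_divide)
  \<comment> \<open>The first component determines \<open>c\<close>, because \<open>g1\<close> has
    no zero on this disc; this makes the factor holomorphic.\<close>
  have geq: "field (\<gamma> s) = cscale (s * e s) (cderiv3 \<gamma> s)" if s: "s \<in> ball 0 R2" for s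
  proof -
    obtain c where c: "field (\<gamma> s) = cscale c (cderiv3 \<gamma> s)" using inv[of s] s R2 by auto
    have "s * p s = c * g1 s"
      using arg_cong[OF c, of fst] by (simp add: p(2) cscale_def cderiv3_def g1_def)
    then have "c = s * e s" using nz[OF s] by (simp add: e_def field_simps)
    then show ?thesis using c by simp
  qed
  obtain m where m: "m holomorphic_on ball 0 R2" "\<And>s. \<mu> - e s = s * m s"
    using holomorphic_factor_zero[of "\<lambda>s. \<mu> - e s" R2]
      holomorphic_on_diff[OF holomorphic_on_const e(1)] e(2) by auto
  have "(\<lambda>s. m s / e s) holomorphic_on ball 0 R2"
    using m(1) e by (intro holomorphic_on_divide) auto
  then obtain E where E: "\<And>s. s \<in> ball 0 R2 \<Longrightarrow> (E has_field_derivative m s / e s) (at s)"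
    "E holomorphic_on ball 0 R2" "E 0 = 0"
    using holomorphic_primitive_ball by blast
  \<comment> \<open>Chosen so that \<open>\<psi> = s \<tau>\<close> satisfies
    \<open>s e \<psi>' = \<mu> \<psi>\<close>, which amounts to
    \<open>\<tau>' / \<tau> = (\<mu> - e) / (s e) = m / e\<close>. The constant \<open>k\<close>
    gives \<open>u\<close> composed with \<psi> the same velocity at 0 as \<gamma>.\<close>
  define \<tau> where "\<tau> s = k * exp (E s)" for s
  have \<tau>: "\<tau> holomorphic_on ball 0 R2" "\<tau> 0 = k"
    unfolding \<tau>_def using E by (auto intro!: holomorphic_intros)
  have d\<tau>: "(\<tau> has_field_derivative \<tau> s * (m s / e s)) (at s)" if "s \<in> ball 0 R2" for s
    unfolding \<tau>_def by (rule derivative_eq_intros refl E(1)[OF that] | simp)+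
  have rel: "e s * (\<tau> s + s * deriv \<tau> s) = \<mu> * \<tau> s" if "s \<in> ball 0 R2" for s
  proof -
    have "e s * (\<tau> s + s * deriv \<tau> s) = \<tau> s * (e s + s * m s)"
      unfolding DERIV_imp_deriv[OF d\<tau>[OF that]] using e(3)[OF that] by (simp add: field_simps)
    also have "e s + s * m s = \<mu>" using m(2)[of s] by (simp add: algebra_simps)
    finally show ?thesis by simp
  qed
  define \<psi> where "\<psi> s = s * \<tau> s" for s
  have h\<psi>: "\<psi> holomorphic_on ball 0 R2" unfolding \<psi>_def by (intro holomorphic_intros \<tau>)
  have d\<psi>: "(\<psi> has_field_derivative \<tau> s + s * deriv \<tau> s) (at s)" if "s \<in> ball 0 R2" for s
    unfolding \<psi>_def
    by (rule derivative_eq_intros refl holomorphic_derivI[OF \<tau>(1) open_ball that] | simp)+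
  have d\<psi>0: "deriv \<psi> 0 = k" using DERIV_imp_deriv[OF d\<psi>[of 0]] R2(1) \<tau>(2) by simp
  have \<psi>0: "\<psi> 0 = 0" by (simp add: \<psi>_def)

  \<comment> \<open>At 0 the norms of \<tau> and \<open>e * \<tau>\<close> are \<open>norm k\<close>
    and \<open>norm \<mu> * norm k\<close>. Near 0 they are bounded by twice the first and below by
    half the second, and the quotient of these bounds is \<open>4 / norm \<mu>\<close>.\<close>
  define K where "K = jconst (4 / norm \<mu>)"
  have K: "K > 0" using mu unfolding K_def by (intro jconst_pos) simp
  define \<epsilon> where "\<epsilon> = 1 / (2 * K)"
  have \<epsilon>: "\<epsilon> > 0" "K * \<epsilon> = 1 / 2" using K by (auto simp: \<epsilon>_def)
  obtain \<rho> where \<rho>: "\<rho> > 0"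
    and lip: "\<And>p q. p \<in> ball 0 \<rho> \<Longrightarrow> q \<in> ball 0 \<rho> \<Longrightarrow> norm (G p - G q) \<le> \<epsilon> * norm (p - q)"
    using G_small[OF \<epsilon>(1)] by blast
  have cont: "isCont \<psi> 0" "isCont \<tau> 0" "isCont e 0"
    using h\<psi> \<tau>(1) e(1) R2(1) holomorphic_isCont_0 by auto
  have cont\<gamma>: "isCont \<gamma> 0" using hcurve_isCont[OF \<gamma>(2)] \<gamma>(1) by simp
  have contu: "isCont (\<lambda>s. u (\<psi> s)) 0"
    using isCont_o2[OF cont(1), of u] hcurve_isCont[OF u(2), of 0] u(1) \<psi>0 by simp
  have cont\<tau>: "isCont (\<lambda>s. norm (\<tau> s)) 0" "isCont (\<lambda>s. norm (e s * \<tau> s)) 0"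
    using cont by (auto intro!: continuous_intros)
  have "\<forall>\<^sub>F s in nhds 0. \<psi> s \<in> ball 0 r \<and> \<gamma> s \<in> ball 0 \<rho> \<and> u (\<psi> s) \<in> ball 0 \<rho> \<and>
      norm (\<tau> s) \<in> {..<2 * norm k} \<and> norm (e s * \<tau> s) \<in> {norm \<mu> * norm k / 2<..}"
    using R2(1) u(1,3) \<psi>0 \<gamma>(3,5) \<rho> \<tau>(2) e(2) mu
    by (intro eventually_conj isCont_eventually_in cont cont\<gamma> contu cont\<tau>
         eventually_nhds_in_open open_ball) (auto simp: norm_mult)
  then obtain d' where d': "d' > 0"
    and d'P: "\<And>s. s \<in> ball 0 d' \<Longrightarrow> \<psi> s \<in> ball 0 r \<and> \<gamma> s \<in> ball 0 \<rho> \<and> u (\<psi> s) \<in> ball 0 \<rho> \<and>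
      norm (\<tau> s) \<in> {..<2 * norm k} \<and> norm (e s * \<tau> s) \<in> {norm \<mu> * norm k / 2<..}"
    by (rule eventually_nhds_0_ball) blast
  define d0 where "d0 = min d' R2"
  have d0: "d0 > 0" and d0R: "d0 \<le> R2" using d' R2(1) by (auto simp: d0_def)
  have s2: "s \<in> ball 0 R2" and s3: "\<psi> s \<in> ball 0 r" and s4: "\<gamma> s \<in> ball 0 \<rho>" and s5: "u (\<psi> s) \<in> ball 0 \<rho>"
    and s6: "norm (\<tau> s) \<le> 2 * norm k" and s7: "norm \<mu> * norm k / 2 \<le> norm (e s * \<tau> s)"
    if "s \<in> ball 0 d0" for s
    using d'P[of s] that by (auto simp: d0_def)
  have sub0: "ball 0 d0 \<subseteq> ball (0::complex) R2" using s2 by blast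
  have h\<gamma>0: "hcurve (ball 0 d0) \<gamma>" using hcurve_smaller_ball[OF \<gamma>(2)] d0R R2(3) by simp
  have du: "((\<lambda>s. u (\<psi> s)) has_derivative
      (\<lambda>\<zeta>. cscale \<zeta> (cscale (\<tau> s + s * deriv \<tau> s) (cderiv3 u (\<psi> s))))) (at s)" if "s \<in> ball 0 d0" for s
    by (rule hcurve_compose_deriv[OF u(2) open_ball s3[OF that] d\<psi>[OF s2[OF that]]])
  have hu0: "hcurve (ball 0 d0) (\<lambda>s. u (\<psi> s))" by (rule hcurveI[OF open_ball du])
  define D where "D s = \<gamma> s - u (\<psi> s)" for s
  have hD: "hcurve (ball 0 d0) D" unfolding D_def by (rule hcurve_diff(1)[OF h\<gamma>0 hu0 open_ball])
  have dD: "cderiv3 D s = cderiv3 \<gamma> s - cscale (\<tau> s + s * deriv \<tau> s) (cderiv3 u (\<psi> s))"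
    if "s \<in> ball 0 d0" for s
    unfolding D_def using hcurve_diff(2)[OF h\<gamma>0 hu0 open_ball that] has_derivative_cscaleD(4)[OF du[OF that]] by simp
  have flatD: "flat_curve d0 D"
    using hD dD[of 0] d0 \<gamma>(3,4) u(3,4) \<psi>0 \<tau>(2) by (simp add: flat_curve_def D_def)
  have Deq: "cscale (s * e s) (cderiv3 D s) - jblock \<mu> (D s) = G (\<gamma> s) - G (u (\<psi> s))"
    if s: "s \<in> ball 0 d0" for s
  proof -
    have "cscale (s * e s) (cscale (\<tau> s + s * deriv \<tau> s) (cderiv3 u (\<psi> s)))
        = cscale (s * (e s * (\<tau> s + s * deriv \<tau> s))) (cderiv3 u (\<psi> s))"
      by (simp add: cscale_cscale mult.assoc)
    also have "\<dots> = cscale (\<mu> * \<psi> s) (cderiv3 u (\<psi> s))"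
      using rel[OF s2[OF s]] by (simp add: \<psi>_def mult_ac)
    also have "\<dots> = field (u (\<psi> s))" using ueq[OF s3[OF s]] .
    finally have "cscale (s * e s) (cderiv3 D s) = field (\<gamma> s) - field (u (\<psi> s))"
      using geq[OF s2[OF s]] by (simp add: dD[OF s] cscale_diff)
    then show ?thesis by (simp add: field_def D_def jblock_diff)
  qed
  \<comment> \<open>The disc is halved so that \<open>flat_curve_bound\<close> provides a finite
    starting constant \<open>B\<close>.\<close>
  define d where "d = d0 / 2"
  have d: "d > 0" "d < d0" using d0 by (auto simp: d_def)
  have sub: "ball 0 d \<subseteq> ball (0::complex) d0" using d by auto
  have flatDd: "flat_curve d D"
    using flatD hcurve_subset[OF _ sub] by (simp add: flat_curve_def)
  obtain B where B: "B \<ge> 0" "\<And>s. s \<in> ball 0 d \<Longrightarrow> norm (D s) \<le> B * (norm s)\<^sup>2"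
    using flat_curve_bound[OF flatD d(2)] by blast
  \<comment> \<open>Each bound on \<open>D\<close> bounds the source term of its equation, and the
    estimate returns half the original bound; iteration forces \<open>D = 0\<close>.\<close>
  have Dn: "norm (D s) \<le> B * (1/2)^n * (norm s)\<^sup>2" if "s \<in> ball 0 d" for n s
    using that
  proof (induction n arbitrary: s)
    case 0 then show ?case using B by simp
  next
    case (Suc n)
    have "norm (D s) \<le> jconst (2 * norm k / (norm \<mu> * norm k / 2)) * (\<epsilon> * (B * (1/2)^n)) * (norm s)\<^sup>2"
    proof (rule jordan_estimate[where e=e and \<tau>=\<tau> and \<mu>=\<mu>, OF _ _ flatDd _ _ _ _ Suc.prems])
      show "norm \<mu> * norm k / 2 > 0" using mu \<gamma>(5) by simp
      show "\<tau> holomorphic_on ball 0 d" using holomorphic_on_subset[OF \<tau>(1)] sub sub0 by blast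
      fix s :: complex assume s: "s \<in> ball 0 d"
      then have s': "s \<in> ball 0 d0" using sub by blast
      show "e s * (\<tau> s + s * deriv \<tau> s) = \<mu> * \<tau> s" using rel[OF s2[OF s']] .
      show "norm \<mu> * norm k / 2 \<le> norm (e s * \<tau> s)" using s7[OF s'] .
      show "norm (\<tau> s) \<le> 2 * norm k" using s6[OF s'] .
      have "norm (G (\<gamma> s) - G (u (\<psi> s))) \<le> \<epsilon> * norm (D s)"
        using lip[OF s4[OF s'] s5[OF s']] by (simp add: D_def)
      also have "\<dots> \<le> \<epsilon> * (B * (1/2)^n * (norm s)\<^sup>2)"
        using Suc.IH[OF s] \<epsilon>(1) by (intro mult_left_mono) auto
      finally show "norm (cscale (s * e s) (cderiv3 D s) - jblock \<mu> (D s)) \<le> \<epsilon> * (B * (1/2)^n) * (norm s)\<^sup>2"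
        unfolding Deq[OF s'] by (simp add: mult.assoc)
    qed
    also have "2 * norm k / (norm \<mu> * norm k / 2) = 4 / norm \<mu>" using \<gamma>(5) by (simp add: field_simps)
    also have "jconst (4 / norm \<mu>) * (\<epsilon> * (B * (1/2)^n)) = (K * \<epsilon>) * (B * (1/2)^n)"
      by (simp add: K_def)
    finally show ?case unfolding \<epsilon>(2) by simp
  qed
  have D0: "D s = 0" if s: "s \<in> ball 0 d" for s
  proof -
    have "(\<lambda>n. B * (1/2)^n * (norm s)\<^sup>2) \<longlonglongrightarrow> B * 0 * (norm s)\<^sup>2"
      by (intro tendsto_intros LIMSEQ_power_zero) simp
    from tendsto_lowerbound[OF this, of "norm (D s)"] Dn[OF s] show ?thesis by simp
  qed
  show ?thesis
  proof (rule that[of d \<psi>])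
    show "d \<le> R" using d(2) d0R R2(3) by linarith
    show "\<psi> holomorphic_on ball 0 d" using holomorphic_on_subset[OF h\<psi>] sub sub0 by blast
    show "\<psi> ` ball 0 d \<subseteq> ball 0 r" using s3 sub by blast
    show "\<gamma> s = u (\<psi> s)" if "s \<in> ball 0 d" for s using D0[OF that] by (simp add: D_def)
  qed (use d(1) \<psi>0 d\<psi>0 in auto)
qed

end

section \<open>Trajectories\<close>

text \<open>Only \<open>u\<close> is known to stay in \<open>U\<close>, where the Lipschitz bound
  holds. The coincidence times form a closed subset of \<open>J\<close>; it is also open, because at
  such a time \<open>v\<close> lies in \<open>U\<close> and remains there briefly. Connectedness of
  \<open>J\<close> concludes.\<close>

lemma ode_unique_in_open:
  fixes u v :: "real \<Rightarrow> 'a::real_normed_vector" and F :: "'a \<Rightarrow> 'a"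
  assumes J: "is_interval J" "t\<^sub>0 \<in> J" and U: "open U"
    and lip: "\<And>p q. p \<in> U \<Longrightarrow> q \<in> U \<Longrightarrow> norm (F p - F q) \<le> L * norm (p - q)" and L: "L > 0"
    and u: "\<And>t. t \<in> J \<Longrightarrow> (u has_vector_derivative F (u t)) (at t within J)" "\<And>t. t \<in> J \<Longrightarrow> u t \<in> U"
    and v: "\<And>t. t \<in> J \<Longrightarrow> (v has_vector_derivative F (v t)) (at t within J)"
    and eq: "v t\<^sub>0 = u t\<^sub>0" and t: "t \<in> J"
  shows "v t = u t"
proof -
  define d where "d t = v t - u t" for t
  have dd: "(d has_vector_derivative F (v t) - F (u t)) (at t within J)" if "t \<in> J" for t
    unfolding d_def by (intro has_vector_derivative_diff u v that)
  have contd: "continuous_on J d" and contv: "continuous_on J v"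
    using has_vector_derivative_continuous[OF dd] has_vector_derivative_continuous[OF v]
    by (auto simp: continuous_on_eq_continuous_within)
  define Z where "Z = {t \<in> J. d t = 0}"
  have "closedin (top_of_set J) Z"
    unfolding Z_def by (rule continuous_closedin_preimage_constant[OF contd])
  moreover have "openin (top_of_set J) Z"
    unfolding openin_contains_ball
  proof (intro conjI ballI)
    show "Z \<subseteq> J" by (auto simp: Z_def)
    fix a assume "a \<in> Z"
    then have a: "a \<in> J" "d a = 0" "v a \<in> U" using u(2)[of a] by (auto simp: Z_def d_def)
    obtain e1 where e1: "e1 > 0" "\<And>t. t \<in> J \<Longrightarrow> dist t a < e1 \<Longrightarrow> v t \<in> U"
    proof -
      obtain e2 where e2: "e2 > 0" "ball (v a) e2 \<subseteq> U" using U a(3) openE by blast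
      then obtain e3 where "e3 > 0" "\<forall>t\<in>J. dist t a < e3 \<longrightarrow> dist (v t) (v a) < e2"
        using contv a(1) unfolding continuous_on_iff by meson
      then show ?thesis using that e2(2) by (metis dist_commute mem_ball subset_iff)
    qed
    \<comment> \<open>With \<open>L * e \<le> 1/2\<close>, the mean value inequality bounds the
      maximum of \<open>norm (d \<tau>)\<close> over the segment from \<open>a\<close> to
      \<open>t\<close> by half of itself, so it is 0.\<close>
    define e where "e = min e1 (1 / (2 * L))"
    have e: "e > 0" "e \<le> e1" "L * e \<le> 1 / 2"
      using e1(1) L mult_left_mono[of e "1 / (2 * L)" L] by (auto simp: e_def)
    have "d t = 0" if t: "t \<in> J" "dist t a < e" for t
    proof -
      define I where "I = closed_segment a t"
      have IJ: "I \<subseteq> J"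
        unfolding I_def using J(1) a(1) t(1) by (simp add: closed_segment_subset is_interval_convex)
      have Id: "dist \<tau> a < e" if "\<tau> \<in> I" for \<tau>
        using that t(2) unfolding I_def closed_segment_eq_real_ivl dist_real_def
        by (auto split: if_splits)
      obtain b where b: "b \<in> I" "\<And>\<tau>. \<tau> \<in> I \<Longrightarrow> norm (d \<tau>) \<le> norm (d b)"
        using continuous_attains_sup[of I "\<lambda>\<tau>. norm (d \<tau>)"] continuous_on_subset[OF contd IJ]
        by (auto simp: I_def intro: continuous_on_norm)
      have "norm (d b - d a) \<le> (L * norm (d b)) * norm (b - a)"
      proof (rule differentiable_bound[where S=I])
        show "convex I" "b \<in> I" "a \<in> I" using b(1) by (auto simp: I_def)
        fix \<tau> assume \<tau>: "\<tau> \<in> I"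
        then have \<tau>J: "\<tau> \<in> J" using IJ by blast
        show "(d has_derivative (\<lambda>h. h *\<^sub>R (F (v \<tau>) - F (u \<tau>)))) (at \<tau> within I)"
          using has_vector_derivative_within_subset[OF dd[OF \<tau>J] IJ]
          by (simp add: has_vector_derivative_def)
        have "norm (F (v \<tau>) - F (u \<tau>)) \<le> L * norm (d \<tau>)"
          using lip[OF e1(2)[OF \<tau>J] u(2)[OF \<tau>J]] Id[OF \<tau>] e(2) by (simp add: d_def)
        also have "\<dots> \<le> L * norm (d b)" using b(2)[OF \<tau>] L by simp
        finally show "onorm (\<lambda>h. h *\<^sub>R (F (v \<tau>) - F (u \<tau>))) \<le> L * norm (d b)"
          by (intro onorm_le) (simp add: mult.commute mult_left_mono)
      qed
      also have "\<dots> = (L * norm (b - a)) * norm (d b)" by simp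
      also have "\<dots> \<le> 1 / 2 * norm (d b)"
      proof (rule mult_right_mono)
        have "L * norm (b - a) \<le> L * e" using Id[OF b(1)] L by (simp add: dist_norm)
        then show "L * norm (b - a) \<le> 1 / 2" using e(3) by simp
      qed simp
      finally have "norm (d b) \<le> 0" using a(2) by simp
      moreover have "t \<in> I" by (simp add: I_def)
      ultimately show ?thesis using b(2)[of t] by simp
    qed
    then have "ball a e \<inter> J \<subseteq> Z" by (auto simp: Z_def dist_commute)
    then show "\<exists>e>0. ball a e \<inter> J \<subseteq> Z" using e(1) by blast
  qed
  moreover have "connected J" using J(1) is_interval_connected by blast
  moreover have "t\<^sub>0 \<in> Z" using J(2) eq by (simp add: Z_def d_def)
  ultimately have "Z = J" by (metis connected_clopen empty_iff)
  then show ?thesis using t by (auto simp: Z_def d_def)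
qed

lemma hcurve_rotation_has_vector_derivative:
  assumes "hcurve (ball 0 r) u" "s * exp (\<mu> * of_real t) \<in> ball 0 r"
  shows "((\<lambda>t. u (s * exp (\<mu> * of_real t))) has_vector_derivative
     cscale (\<mu> * (s * exp (\<mu> * of_real t))) (cderiv3 u (s * exp (\<mu> * of_real t)))) (at t)"
proof -
  have "((\<lambda>t. s * exp (\<mu> * of_real t)) has_vector_derivative \<mu> * (s * exp (\<mu> * of_real t))) (at t)"
    by (rule has_vector_derivative_real_field)
       (rule derivative_eq_intros refl | simp)+
  from has_derivative_compose[OF this[unfolded has_vector_derivative_def]
      hcurve_has_derivative[OF assms(1) open_ball assms(2)]]
  show ?thesis
    by (simp add: has_vector_derivative_def cscale_def scaleR_conv_of_real mult.assoc)
qed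

text \<open>At time \<open>2 * pi / \<bar>\<omega>\<bar>\<close> the angle is a full turn in the
  direction of the sign of \<omega>. An earlier positive return would need an even integer strictly
  between 0 and 2.\<close>

lemma rotation_period:
  assumes "\<omega> \<noteq> 0"
  shows "exp (\<i> * of_real \<omega> * of_real (t + 2 * pi / \<bar>\<omega>\<bar>)) = exp (\<i> * of_real \<omega> * of_real t)"
    and "0 < t \<Longrightarrow> t < 2 * pi / \<bar>\<omega>\<bar> \<Longrightarrow> exp (\<i> * of_real \<omega> * of_real t) \<noteq> 1"
proof -
  have "\<omega> * (2 * pi / \<bar>\<omega>\<bar>) = 2 * pi * sgn \<omega>" using assms by (simp add: sgn_if)
  then have "exp (\<i> * of_real \<omega> * of_real (2 * pi / \<bar>\<omega>\<bar>)) = 1"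
    unfolding exp_eq_1 using assms
    by (auto intro!: exI[of _ "if \<omega> > 0 then 1 else -1"] simp: sgn_if split: if_splits)
  then show "exp (\<i> * of_real \<omega> * of_real (t + 2 * pi / \<bar>\<omega>\<bar>)) = exp (\<i> * of_real \<omega> * of_real t)"
    by (simp add: distrib_left exp_add)
  assume t: "0 < t" "t < 2 * pi / \<bar>\<omega>\<bar>"
  show "exp (\<i> * of_real \<omega> * of_real t) \<noteq> 1"
  proof
    assume "exp (\<i> * of_real \<omega> * of_real t) = 1"
    then obtain n :: int where n: "\<omega> * t = of_int (2 * n) * pi" unfolding exp_eq_1 by auto
    then have "\<bar>\<omega>\<bar> * t = of_int \<bar>2 * n\<bar> * pi" using t(1) by (metis abs_mult abs_of_pos of_int_abs pi_gt_zero)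
    moreover have "\<bar>\<omega>\<bar> * t < 2 * pi" using t(2) assms by (simp add: field_simps)
    moreover have "\<bar>\<omega>\<bar> * t > 0" using t(1) assms by simp
    ultimately have "(0::real) < of_int \<bar>2 * n\<bar>" "of_int \<bar>2 * n\<bar> < (2::real)"
      by (auto simp: zero_less_mult_iff)
    then have "0 < \<bar>2 * n\<bar>" "\<bar>2 * n\<bar> < 2" by linarith+
    then show False by presburger
  qed
qed

section \<open>Germs of invariant manifolds\<close>

lemma same_germ_reparametrized:
  assumes u: "homeomorphism (ball 0 r) S u u'" "u 0 = 0"
    and \<gamma>: "homeomorphism (ball 0 R) (S' \<inter> U) \<gamma> \<gamma>'" "open U" "0 \<in> U" "\<gamma> 0 = 0"
    and d: "d > 0" "d \<le> R" and \<psi>: "\<psi> holomorphic_on ball 0 d" "\<psi> 0 = 0" "deriv \<psi> 0 \<noteq> 0"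
      "\<psi> ` ball 0 d \<subseteq> ball 0 r"
    and eq: "\<And>s. s \<in> ball 0 d \<Longrightarrow> \<gamma> s = u (\<psi> s)"
  shows "same_germ S S'"
proof -
  have im: "u ` ball 0 r = S" "\<gamma> ` ball 0 R = S' \<inter> U" using u(1) \<gamma>(1) by (auto simp: homeomorphism_def)
  have 0: "0 \<in> ball (0::complex) d" using d by simp
  have sub: "ball (0::complex) d \<subseteq> ball 0 R" using d(2) by (rule subset_ball)
  have "openin (top_of_set (S' \<inter> U)) (\<gamma> ` ball 0 d)"
    using homeomorphism_imp_open_map[OF \<gamma>(1)] sub by (simp add: open_subset)
  then obtain V1 where V1: "open V1" "\<gamma> ` ball 0 d = S' \<inter> U \<inter> V1" unfolding openin_open by blast
  have nc: "\<not> \<psi> constant_on ball 0 d"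
  proof
    assume "\<psi> constant_on ball 0 d"
    then obtain c where c: "\<And>s. s \<in> ball 0 d \<Longrightarrow> \<psi> s = c" unfolding constant_on_def by blast
    have "(\<psi> has_field_derivative 0) (at 0)"
      by (rule has_field_derivative_transform_within_open[OF DERIV_const open_ball 0]) (simp add: c)
    then show False using \<psi>(3) DERIV_imp_deriv by blast
  qed
  have "open (\<psi> ` ball 0 d)"
    by (rule open_mapping_thm[OF \<psi>(1) open_ball connected_ball open_ball subset_refl nc])
  then have "openin (top_of_set S) (u ` \<psi> ` ball 0 d)"
    using homeomorphism_imp_open_map[OF u(1)] \<psi>(4) by (simp add: open_subset)
  then obtain V2 where V2: "open V2" "u ` \<psi> ` ball 0 d = S \<inter> V2" unfolding openin_open by blast
  have img: "u ` \<psi> ` ball 0 d = \<gamma> ` ball 0 d" using eq by (force simp: image_image)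
  have z: "0 \<in> \<gamma> ` ball 0 d" using \<gamma>(4) 0 by (metis image_eqI)
  show ?thesis
    unfolding same_germ_def
  proof (intro exI conjI)
    show "open (U \<inter> V1 \<inter> V2)" using \<gamma>(2) V1 V2 by auto
    show "0 \<in> U \<inter> V1 \<inter> V2" using z V1(2) V2(2) img by auto
    show "S \<inter> (U \<inter> V1 \<inter> V2) = S' \<inter> (U \<inter> V1 \<inter> V2)" using V1(2) V2(2) img by auto
  qed
qed

text \<open>Near 0 the first coordinate of \<open>u\<close> is injective, hence has nonzero
  derivative and a holomorphic inverse \<open>g\<close>; projecting to that coordinate and applying
  \<open>g\<close> inverts \<open>u\<close> continuously.\<close>

lemma hcurve_regular_homeomorphism:
  assumes "hcurve (ball 0 r) u" "r > 0" "fst (cderiv3 u 0) \<noteq> 0"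
  obtains r' where "r' > 0" "r' \<le> r" "\<And>s. s \<in> ball 0 r' \<Longrightarrow> cderiv3 u s \<noteq> 0"
    "\<And>R. R \<le> r' \<Longrightarrow> \<exists>u'. homeomorphism (ball 0 R) (u ` ball 0 R) u u'"
proof -
  have h: "(\<lambda>s. fst (u s)) holomorphic_on ball 0 r" using assms(1) by (simp add: hcurve_def)
  have 0: "0 \<in> ball (0::complex) r" and nz: "deriv (\<lambda>s. fst (u s)) 0 \<noteq> 0"
    using assms(2,3) by (simp_all add: cderiv3_def)
  obtain r0 where r0: "r0 > 0" "inj_on (\<lambda>s. fst (u s)) (ball 0 r0)"
    by (rule has_complex_derivative_locally_injective[OF h 0 open_ball nz])
  define r' where "r' = min r0 r"
  have r': "r' > 0" "r' \<le> r" using r0(1) assms(2) by (auto simp: r'_def)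
  have inj: "inj_on (\<lambda>s. fst (u s)) (ball 0 r')"
    by (rule inj_on_subset[OF r0(2)]) (simp add: r'_def subset_ball)
  have h': "(\<lambda>s. fst (u s)) holomorphic_on ball 0 r'"
    using hcurve_smaller_ball[OF assms(1) r'(2)] by (simp add: hcurve_def)
  show ?thesis
  proof (rule that[OF r'])
    show "cderiv3 u s \<noteq> 0" if "s \<in> ball 0 r'" for s
      using holomorphic_injective_imp_regular[OF h' open_ball inj that]
      by (auto simp: cderiv3_def zero_prod_def)
    fix R assume R: "R \<le> r'"
    then have sub: "ball (0::complex) R \<subseteq> ball 0 r'" by (rule subset_ball)
    obtain g where g: "g holomorphic_on (\<lambda>s. fst (u s)) ` ball 0 R"
      "\<And>s. s \<in> ball 0 R \<Longrightarrow> g (fst (u s)) = s"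
      by (rule holomorphic_has_inverse[OF holomorphic_on_subset[OF h' sub] open_ball inj_on_subset[OF inj sub]]) blast
    have "continuous_on (u ` ball 0 R) (\<lambda>p. g (fst p))"
      by (rule continuous_on_compose2[OF holomorphic_on_imp_continuous_on[OF g(1)]])
         (auto intro!: continuous_intros)
    moreover have "continuous_on (ball 0 R) u"
      using hcurve_continuous_on[OF hcurve_smaller_ball[OF assms(1)]] R r'(2) by simp
    ultimately have "homeomorphism (ball 0 R) (u ` ball 0 R) u (\<lambda>p. g (fst p))"
      using g(2) by (force simp: homeomorphism_def image_iff)
    then show "\<exists>u'. homeomorphism (ball 0 R) (u ` ball 0 R) u u'" by blast
  qed
qed

lemma inv_center_manifoldE:
  assumes "inv_center_manifold F e S"
  obtains U r \<gamma> \<gamma>' k where "open U" "0 \<in> U" "r > 0" "hcurve (ball 0 r) \<gamma>" "\<gamma> 0 = 0"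
    "homeomorphism (ball 0 r) (S \<inter> U) \<gamma> \<gamma>'" "cderiv3 \<gamma> 0 = cscale k e" "k \<noteq> 0"
    "\<And>s. s \<in> ball 0 r \<Longrightarrow> \<exists>c. F (\<gamma> s) = cscale c (cderiv3 \<gamma> s)"
proof -
  obtain U r \<gamma> \<gamma>' k where *: "open U" "0 \<in> U" "r > 0" "hcurve (ball 0 r) \<gamma>" "\<gamma> 0 = 0"
    "homeomorphism (ball 0 r) (S \<inter> U) \<gamma> \<gamma>'" "cderiv3 \<gamma> 0 = cscale k e"
    "\<forall>s\<in>ball 0 r. cderiv3 \<gamma> s \<noteq> 0"
    "\<forall>s\<in>ball 0 r. \<exists>c. F (\<gamma> s) = cscale c (cderiv3 \<gamma> s)"
    using assms unfolding inv_center_manifold_def hcurve_def by blast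
  have "cderiv3 \<gamma> 0 \<noteq> 0" using *(3,8) by simp
  then have "k \<noteq> 0" using *(7) by (auto simp: cscale_def zero_prod_def)
  then show ?thesis using that * by blast
qed

context jordan_field
begin

text \<open>For \<open>v = (0, k, 0)\<close> the block gives \<open>(k, \<mu> * k, 0)\<close>, and
  the first minor condition becomes \<open>k * k = 0\<close>.\<close>

lemma no_y_manifold: "\<not> inv_center_manifold field y_axis S"
proof
  assume S: "inv_center_manifold field y_axis S"
  obtain r \<gamma> k where "r > 0" "hcurve (ball 0 r) \<gamma>" "\<gamma> 0 = 0" "cderiv3 \<gamma> 0 = cscale k y_axis" "k \<noteq> 0"
    "\<And>s. s \<in> ball 0 r \<Longrightarrow> \<exists>c. field (\<gamma> s) = cscale c (cderiv3 \<gamma> s)"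
    by (rule inv_center_manifoldE[OF S]) blast
  then show False
    using tangent_eigenvector(1)[of r \<gamma> "cscale k y_axis"]
    by (simp add: jblock_def cscale_def y_axis_def)
qed

text \<open>For \<open>v = (0, 0, k)\<close> the first minor is trivial; the block gives
  \<open>(0, k, \<mu> * k)\<close>, and the second one becomes \<open>k * k = 0\<close>.\<close>

lemma no_z_manifold: "\<not> inv_center_manifold field z_axis S"
proof
  assume S: "inv_center_manifold field z_axis S"
  obtain r \<gamma> k where "r > 0" "hcurve (ball 0 r) \<gamma>" "\<gamma> 0 = 0" "cderiv3 \<gamma> 0 = cscale k z_axis" "k \<noteq> 0"
    "\<And>s. s \<in> ball 0 r \<Longrightarrow> \<exists>c. field (\<gamma> s) = cscale c (cderiv3 \<gamma> s)"
    by (rule inv_center_manifoldE[OF S]) blast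
  then show False
    using tangent_eigenvector(2)[of r \<gamma> "cscale k z_axis"]
    by (simp add: jblock_def cscale_def z_axis_def)
qed

lemma field_lipschitz:
  obtains \<rho> L where "\<rho> > 0" "L > 0"
    "\<And>p q. p \<in> ball 0 \<rho> \<Longrightarrow> q \<in> ball 0 \<rho> \<Longrightarrow> norm (field p - field q) \<le> L * norm (p - q)"
proof -
  obtain \<rho> where \<rho>: "\<rho> > 0" "\<forall>p\<in>ball 0 \<rho>. \<forall>q\<in>ball 0 \<rho>. norm (G p - G q) \<le> 1 * norm (p - q)"
    using G_small[of 1] by auto
  obtain K where K: "K > 0" "\<And>p. norm (jblock \<mu> p) \<le> norm p * K"
    using bounded_linear.pos_bounded[OF bounded_linear_jblock] by blast
  have "norm (field p - field q) \<le> (K + 1) * norm (p - q)" if "p \<in> ball 0 \<rho>" "q \<in> ball 0 \<rho>" for p q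
  proof -
    have "field p - field q = jblock \<mu> (p - q) + (G p - G q)"
      by (simp add: field_def jblock_diff)
    then have "norm (field p - field q) \<le> norm (jblock \<mu> (p - q)) + norm (G p - G q)"
      using norm_triangle_ineq by metis
    moreover have "norm (G p - G q) \<le> norm (p - q)" using \<rho>(2) that by fastforce
    ultimately show ?thesis using K(2)[of "p - q"] by (simp add: algebra_simps)
  qed
  then show ?thesis using that[OF \<rho>(1), of "K + 1"] K(1) by simp
qed

text \<open>As \<mu> is purely imaginary, multiplication by \<open>exp (\<mu> * t)\<close> preserves
  every circle in the disc, and \<open>u\<close> carries these rotations to trajectories.
  Injectivity of \<open>u\<close> keeps the period minimal, and the local Lipschitz bound excludes
  other trajectories.\<close>

lemma x_manifold:
  assumes "\<mu> = \<i> * of_real \<omega>"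
  obtains S where "inv_center_manifold field x_axis S"
    "isochronous_family field S (2 * pi / \<bar>\<omega>\<bar>)"
    "\<And>S'. inv_center_manifold field x_axis S' \<Longrightarrow> same_germ S S'"
proof -
  obtain r0 u where r0: "r0 > 0" and hu0: "hcurve (ball 0 r0) u" and u0: "u 0 = 0" "cderiv3 u 0 = x_axis"
    and ueq0: "\<And>s. s \<in> ball 0 r0 \<Longrightarrow> cscale (\<mu> * s) (cderiv3 u s) = field (u s)"
    by (rule invariant_curve_exists) blast
  have "fst (cderiv3 u 0) \<noteq> 0" using u0(2) by (simp add: x_axis_def)
  then obtain r1 where r1: "r1 > 0" "r1 \<le> r0" and reg: "\<And>s. s \<in> ball 0 r1 \<Longrightarrow> cderiv3 u s \<noteq> 0"
    and hom: "\<And>R. R \<le> r1 \<Longrightarrow> \<exists>u'. homeomorphism (ball 0 R) (u ` ball 0 R) u u'"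
    using hcurve_regular_homeomorphism[OF hu0 r0] by blast
  obtain \<rho> L where \<rho>: "\<rho> > 0" and L: "L > 0"
    and lip: "\<And>p q. p \<in> ball 0 \<rho> \<Longrightarrow> q \<in> ball 0 \<rho> \<Longrightarrow> norm (field p - field q) \<le> L * norm (p - q)"
    by (rule field_lipschitz) blast
  have "isCont u 0" using hcurve_isCont[OF hu0, of 0] r0 by simp
  from isCont_eventually_in[OF this, of "ball 0 \<rho>"] \<rho> u0(1)
  obtain r2 where r2: "r2 > 0" "\<And>s. s \<in> ball 0 r2 \<Longrightarrow> u s \<in> ball 0 \<rho>"
    by (auto elim: eventually_nhds_0_ball simp del: mem_ball)
  \<comment> \<open>On this disc \<open>u\<close> is regular and a homeomorphism onto its image, and
    that image lies in the ball where \<open>field\<close> is Lipschitz.\<close>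
  define r where "r = min r1 r2"
  have r: "r > 0" "r \<le> r1" "r \<le> r2" "r \<le> r0" using r1 r2 by (auto simp: r_def)
  have sub: "ball (0::complex) r \<subseteq> ball 0 r0" "ball (0::complex) r \<subseteq> ball 0 r1"
    "ball (0::complex) r \<subseteq> ball 0 r2" using r by (auto intro: subset_ball)
  have hu: "hcurve (ball 0 r) u" by (rule hcurve_smaller_ball[OF hu0 r(4)])
  have ueq: "cscale (\<mu> * s) (cderiv3 u s) = field (u s)" if "s \<in> ball 0 r" for s
    using ueq0 sub(1) that by blast
  define S where "S = u ` ball 0 r"
  obtain u' where u': "homeomorphism (ball 0 r) S u u'" using hom[OF r(2)] by (auto simp: S_def)
  have inj: "inj_on u (ball 0 r)" by (rule inj_on_inverseI) (rule homeomorphism_apply1[OF u'])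
  show ?thesis
  proof (rule that)
    have "cderiv3 u 0 = cscale 1 x_axis" using u0(2) by (simp add: cscale_def)
    moreover have "homeomorphism (ball 0 r) (S \<inter> UNIV) u u'" using u' by simp
    moreover have "\<forall>s\<in>ball 0 r. \<exists>c. field (u s) = cscale c (cderiv3 u s)" using ueq by metis
    moreover have "\<forall>s\<in>ball 0 r. cderiv3 u s \<noteq> 0" using reg sub(2) by blast
    ultimately show "inv_center_manifold field x_axis S"
      unfolding inv_center_manifold_def using hu[unfolded hcurve_def] r(1) u0(1) open_UNIV UNIV_I by blast
    show "same_germ S S'" if S': "inv_center_manifold field x_axis S'" for S'
    proof -
      obtain U R \<gamma> \<gamma>' k where *: "open U" "0 \<in> U" "R > 0" "hcurve (ball 0 R) \<gamma>" "\<gamma> 0 = 0"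
        "homeomorphism (ball 0 R) (S' \<inter> U) \<gamma> \<gamma>'" "cderiv3 \<gamma> 0 = cscale k x_axis" "k \<noteq> 0"
        and inv: "\<And>s. s \<in> ball 0 R \<Longrightarrow> \<exists>c. field (\<gamma> s) = cscale c (cderiv3 \<gamma> s)"
        by (rule inv_center_manifoldE[OF S']) blast
      obtain d \<psi> where d: "d > 0" "d \<le> R" and \<psi>: "\<psi> holomorphic_on ball 0 d" "\<psi> 0 = 0" "deriv \<psi> 0 = k"
        "\<psi> ` ball 0 d \<subseteq> ball 0 r" and eq: "\<And>s. s \<in> ball 0 d \<Longrightarrow> \<gamma> s = u (\<psi> s)"
        by (rule invariant_curve_unique[OF r(1) hu u0 ueq *(3,4,5,7,8) inv]) blast+
      show ?thesis
        by (rule same_germ_reparametrized[OF u' u0(1) *(6,1,2,5) d \<psi>(1,2) _ \<psi>(4) eq])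
           (use \<psi>(3) *(8) in auto)
    qed
    show "isochronous_family field S (2 * pi / \<bar>\<omega>\<bar>)"
      unfolding isochronous_family_def
    \<comment> \<open>The radius 1 is an arbitrary witness: smallness is already built into
      \<open>S\<close>, the image of a disc filled by circular orbits.\<close>
    proof (intro exI[of _ 1] conjI ballI impI)
      fix p assume "p \<in> S" and "p \<noteq> 0 \<and> norm p < 1"
      then obtain s where s: "p = u s" "s \<in> ball 0 r" "s \<noteq> 0" using u0(1) unfolding S_def by blast
      define x where "x t = s * exp (\<mu> * of_real t)" for t
      have nx: "x t \<in> ball 0 r" for t using s(2) by (simp add: x_def norm_mult assms)
      have ux: "u (x t) \<in> ball 0 \<rho>" for t using r2(2) sub(3) nx by blast
      have der: "((\<lambda>t. u (x t)) has_vector_derivative field (u (x t))) (at t)" for t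
        using hcurve_rotation_has_vector_derivative[OF hu nx[unfolded x_def]] ueq[OF nx]
        by (simp add: x_def)
      have \<omega>: "\<omega> \<noteq> 0" using mu assms by auto
      have x0: "x 0 = s" by (simp add: x_def)
      show "\<exists>y. y 0 = p \<and> (\<forall>t. (y has_vector_derivative field (y t)) (at t)) \<and>
          (\<forall>t. y (t + 2 * pi / \<bar>\<omega>\<bar>) = y t) \<and> (\<forall>t. 0 < t \<and> t < 2 * pi / \<bar>\<omega>\<bar> \<longrightarrow> y t \<noteq> p) \<and>
          (\<forall>J v. is_interval J \<and> 0 \<in> J \<and> v 0 = p \<and>
             (\<forall>t\<in>J. (v has_vector_derivative field (v t)) (at t within J)) \<longrightarrow> (\<forall>t\<in>J. v t = y t))"
      proof (intro exI[of _ "\<lambda>t. u (x t)"] conjI allI impI ballI)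
        show "u (x 0) = p" by (simp add: x0 s(1))
        show "((\<lambda>t. u (x t)) has_vector_derivative field (u (x t))) (at t)" for t by (rule der)
        show "u (x (t + 2 * pi / \<bar>\<omega>\<bar>)) = u (x t)" for t
          unfolding x_def assms using rotation_period(1)[OF \<omega>] by simp
        show "u (x t) \<noteq> p" if "0 < t \<and> t < 2 * pi / \<bar>\<omega>\<bar>" for t
        proof
          assume "u (x t) = p"
          then have "x t = s" using inj nx s(1,2) by (auto dest: inj_onD)
          then show False using rotation_period(2)[OF \<omega>] that s(3) by (simp add: x_def assms)
        qed
        fix J v t
        assume *: "is_interval J \<and> 0 \<in> J \<and> v 0 = p \<and>
             (\<forall>t\<in>J. (v has_vector_derivative field (v t)) (at t within J))" and t: "t \<in> J"
        show "v t = u (x t)"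
          by (rule ode_unique_in_open[where J=J and t\<^sub>0=0 and U="ball 0 \<rho>" and F=field and L=L])
             (use * t lip L ux x0 s(1) has_vector_derivative_at_within[OF der] in auto)
      qed
    qed simp
  qed
qed

end

text \<open>The norm on triples is at most the sum of the component norms, hence
  \<open>\<epsilon> / 3\<close> for each of \<open>f\<close>, \<open>g\<close>, \<open>h\<close> on
  a common ball.\<close>

lemma jordan_field_sys:
  assumes "\<omega> \<noteq> 0" and hol: "hol3_near0 f" "hol3_near0 g" "hol3_near0 h"
    and van: "vanish_order2 f" "vanish_order2 g" "vanish_order2 h"
  shows "jordan_field (\<i> * of_real \<omega>) (\<lambda>p. (f p, g p, h p))"
proof
  show "\<i> * of_real \<omega> \<noteq> 0" using assms(1) by simp
  show "(f 0, g 0, h 0) = 0" using van by (simp add: vanish_order2_def zero_prod_def)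
  show "cderiv3 (\<lambda>s. (f (\<gamma> s), g (\<gamma> s), h (\<gamma> s))) 0 = 0"
    if "hcurve B \<gamma>" "open B" "0 \<in> B" "\<gamma> 0 = 0" for B \<gamma>
    using vanish_order2_compose[OF van(1) that] vanish_order2_compose[OF van(2) that]
      vanish_order2_compose[OF van(3) that]
    by (simp add: cderiv3_def DERIV_imp_deriv zero_prod_def)
  fix \<epsilon> :: real assume "\<epsilon> > 0"
  then have \<epsilon>: "\<epsilon> / 3 > 0" by simp
  obtain \<rho>1 where 1: "\<rho>1 > 0" "hol3_on (ball 0 \<rho>1) f"
    "\<And>p q. p \<in> ball 0 \<rho>1 \<Longrightarrow> q \<in> ball 0 \<rho>1 \<Longrightarrow> norm (f p - f q) \<le> \<epsilon> / 3 * norm (p - q)"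
    by (rule hol3_small_lipschitz[OF hol(1) van(1) \<epsilon>]) blast
  obtain \<rho>2 where 2: "\<rho>2 > 0" "hol3_on (ball 0 \<rho>2) g"
    "\<And>p q. p \<in> ball 0 \<rho>2 \<Longrightarrow> q \<in> ball 0 \<rho>2 \<Longrightarrow> norm (g p - g q) \<le> \<epsilon> / 3 * norm (p - q)"
    by (rule hol3_small_lipschitz[OF hol(2) van(2) \<epsilon>]) blast
  obtain \<rho>3 where 3: "\<rho>3 > 0" "hol3_on (ball 0 \<rho>3) h"
    "\<And>p q. p \<in> ball 0 \<rho>3 \<Longrightarrow> q \<in> ball 0 \<rho>3 \<Longrightarrow> norm (h p - h q) \<le> \<epsilon> / 3 * norm (p - q)"
    by (rule hol3_small_lipschitz[OF hol(3) van(3) \<epsilon>]) blast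
  define \<rho> where "\<rho> = min \<rho>1 (min \<rho>2 \<rho>3)"
  have \<rho>: "\<rho> > 0" "ball (0::c3) \<rho> \<subseteq> ball 0 \<rho>1" "ball (0::c3) \<rho> \<subseteq> ball 0 \<rho>2" "ball (0::c3) \<rho> \<subseteq> ball 0 \<rho>3"
    using 1(1) 2(1) 3(1) by (auto simp: \<rho>_def)
  have "norm ((f p, g p, h p) - (f q, g q, h q)) \<le> \<epsilon> * norm (p - q)"
    if "p \<in> ball 0 \<rho>" "q \<in> ball 0 \<rho>" for p q
  proof -
    have pq: "p \<in> ball 0 \<rho>1" "q \<in> ball 0 \<rho>1" "p \<in> ball 0 \<rho>2" "q \<in> ball 0 \<rho>2"
      "p \<in> ball 0 \<rho>3" "q \<in> ball 0 \<rho>3" using \<rho> that by blast+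
    show ?thesis
      using norm_c3_le_sum[of "(f p, g p, h p) - (f q, g q, h q)"] 1(3)[OF pq(1,2)] 2(3)[OF pq(3,4)]
        3(3)[OF pq(5,6)] by simp
  qed
  moreover have "hcurve B (\<lambda>s. (f (\<gamma> s), g (\<gamma> s), h (\<gamma> s)))"
    if "open B" "hcurve B \<gamma>" "\<gamma> ` B \<subseteq> ball 0 \<rho>" for B \<gamma>
    using hol3_on_compose[OF 1(2) that(2,1) subset_trans[OF that(3) \<rho>(2)]]
      hol3_on_compose[OF 2(2) that(2,1) subset_trans[OF that(3) \<rho>(3)]]
      hol3_on_compose[OF 3(2) that(2,1) subset_trans[OF that(3) \<rho>(4)]]
    by (simp add: hcurve_def)
  ultimately show "\<exists>\<rho>>0. (\<forall>p\<in>ball 0 \<rho>. \<forall>q\<in>ball 0 \<rho>.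
        norm ((f p, g p, h p) - (f q, g q, h q)) \<le> \<epsilon> * norm (p - q)) \<and>
      (\<forall>B \<gamma>. open B \<longrightarrow> hcurve B \<gamma> \<longrightarrow> \<gamma> ` B \<subseteq> ball 0 \<rho> \<longrightarrow> hcurve B (\<lambda>s. (f (\<gamma> s), g (\<gamma> s), h (\<gamma> s))))"
    using \<rho>(1) by blast
qed

theorem theorem3p10:
  fixes \<omega> :: real and f g h :: "c3 \<Rightarrow> complex"
  assumes "\<omega> \<noteq> 0"
    and "hol3_near0 f" and "hol3_near0 g" and "hol3_near0 h"
    and "vanish_order2 f" and "vanish_order2 g" and "vanish_order2 h"
  shows "(\<exists>S. inv_center_manifold (sys \<omega> f g h) x_axis S \<and>
             isochronous_family (sys \<omega> f g h) S (2 * pi / \<bar>\<omega>\<bar>) \<and>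
             (\<forall>S'. inv_center_manifold (sys \<omega> f g h) x_axis S' \<longrightarrow> same_germ S S'))
       \<and> \<not> (\<exists>S. inv_center_manifold (sys \<omega> f g h) y_axis S)
       \<and> \<not> (\<exists>S. inv_center_manifold (sys \<omega> f g h) z_axis S)"
proof -
  interpret jordan_field "\<i> * of_real \<omega>" "\<lambda>p. (f p, g p, h p)"
    by (rule jordan_field_sys[OF assms])
  have sys: "sys \<omega> f g h = field"
    by (rule ext) (simp add: sys_def field_def jblock_def Let_def)
  obtain S where "inv_center_manifold field x_axis S"
    "isochronous_family field S (2 * pi / \<bar>\<omega>\<bar>)"
    "\<And>S'. inv_center_manifold field x_axis S' \<Longrightarrow> same_germ S S'"
    by (rule x_manifold[OF refl]) blast
  then show ?thesis
    unfolding sys using no_y_manifold no_z_manifold by blast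
qed

end
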